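(* Let $A$ be the block tridiagonal system matrix defined in the context, with parameter $r>0$, built from the cross-diffusion matrix $D=\begin{bmatrix}d^1&d^2\\d^3&d^4\end{bmatrix}$ and the functions $\lambda_1,\lambda_2$. Let $x=(u,v,t)$ denote the argument of these functions and put $k_i(x)=1+\tfrac12 r\lambda_i(x)$, $i=1,2$. Consider the following conditions. 1. $\lambda_1(x)=\lambda_2(x)$ for all $x$. 2. $\lambda_1(x)>\lambda_2(x)$ for all $x$, and $$\begin{bmatrix}k_1^2(x)+4r(k_1(x)-k_2(x))d^1(x)&2r(k_1(x)-k_2(x))d^2(x)\\2r(k_1(x)-k_2(x))d^2(x)&k_2^2(x)\end{bmatrix}$$ is positive semi-definite for all $x$. 3. $\lambda_2(x)>\lambda_1(x)$ for all $x$, and $$\begin{bmatrix}k_1^2(x)&2r(k_2(x)-k_1(x))d^3(x)\\2r(k_2(x)-k_1(x))d^3(x)&k_2^2(x)+4r(k_2(x)-k_1(x))d^4(x)\end{bmatrix}$$ is positive semi-definite for all $x$. 4. $\lambda_1(x)-\lambda_2(x)$ changes sign, and the two matrices displayed in 2 and 3 are positive semi-definite for all $x$. (a) If one of the conditions 1–4 holds and the cross-diffusion matrix is of the form $g(\cdot)M$ for some non-negative real-valued function $g$ and positive semi-definite matrix $M\in\mathbb R^{2\times 2}$, then the stable block $LU$ factorization of $A$ described in the context exists and is unique, for any choice of $r$ (that is, of $r=2\theta\Delta t$ for the AOS-CD scheme and $r=\theta\Delta t$ for the AMOS-CD scheme). (b) Furthermore, for a general positive semi-definite, not necessarily symmetric,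 cross-diffusion matrix, if one of the conditions 1–4 holds with the requirement on the matrices in 2–4 changed to positive definiteness, then the stable block $LU$ factorization of $A$ exists and is unique for sufficiently small $r$.
   Context: Setting: $d^1,\dots,d^4:\mathbb R^2\times[0,\infty)\to\mathbb R$, and $\lambda_1,\lambda_2:\mathbb R^2\times[0,\infty)\to[0,\infty)$ bounded. A matrix is called positive (semi-)definite, without qualifier, in the usual sense, including symmetry; a real square matrix $P$ is positive (semi-)definite, not necessarily symmetric, if $\xi^\top P\xi>0$ for all real $\xi\neq 0$ (resp. $\ge0$ for all real $\xi$). The cross-diffusion matrix $D$ has such a property if $D(u,v,t)$ has it for all $(u,v,t)$. System matrix: it arises from one directional step of the AOS-CD or AMOS-CD operator splitting of a $\theta$-scheme (time step $\Delta t$, parameter $\theta$) for the cross-diffusion system $u_t=\nabla\cdot(d^1\nabla u+d^2\nabla v)-\lambda_1(u-u^0)$, $v_t=\nabla\cdot(d^3\nabla u+d^4\nabla v)-\lambda_2(v-v^0)$ with homogeneous Neumann conditions, with unit grid spacing. Fix node values $w_1,\dots,w_{N_1}\in\mathbb R^2$ (the values of $(U,V)$ along one grid line), a time $t\ge0$ and $r>0$. Put $D_j=D(w_j,t)$, $D_{j+1/2}=\tfrac12(D_j+D_{j+1})$ and $K_j=\mathrm{diag}\big(1+\tfrac12r\lambda_1(w_j,t),\,1+\tfrac12r\lambda_2(w_j,t)\big)$. The matrix $A\in\mathbb R^{2N_1\times2N_1}$ is block tridiagonal with $2\times2$ blocks: diagonal blocks $B_1,\dots,B_{N_1}$, superdiagonal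 blocks $U_1,\dots,U_{N_1-1}$ ($U_j$ in block row $j$), subdiagonal blocks $L_1,\dots,L_{N_1-1}$ ($L_j$ in block row $j+1$), where $B_1=K_1+2rD_{3/2}$, $B_{N_1}=K_{N_1}+2rD_{N_1-1/2}$, $B_j=K_j+r(D_{j-1/2}+D_{j+1/2})$ for $1<j<N_1$; $U_1=-2rD_{3/2}$, $U_j=-rD_{j+1/2}$ for $2\le j\le N_1-1$; $L_{N_1-1}=-2rD_{N_1-1/2}$, $L_j=-rD_{j+1/2}$ for $1\le j\le N_1-2$. Standing assumption: all off-diagonal blocks $U_j,L_j$ are nonzero. Block $LU$ factorization: $A=LU$ with $L$ block lower bidiagonal having diagonal blocks $\bar B_1,\dots,\bar B_{N_1}$ and subdiagonal blocks $L_1,\dots,L_{N_1-1}$, and $U$ block upper bidiagonal having identity diagonal blocks $I_2$ and superdiagonal blocks $\bar U_1,\dots,\bar U_{N_1-1}$, where $\bar B_1=B_1$, $\bar B_j\bar U_j=U_j$ and $\bar B_{j+1}=B_{j+1}-L_j\bar U_j$ for $j=1,\dots,N_1-1$. Stability of the factorization: the ratio $\|L\|\,\|U\|/\|A\|$ is bounded by a function of $N_1$ ($\|\cdot\|$ is the spectral norm).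
   Formalization: In part (a) the function of N₁ bounding the stability ratio may also depend on the matrix M (not on g, λ₁, λ₂, r, node values or time); a bound by N₁ alone fails, e.g. for N₁=2, M=vvᵀ with v=(1,k^(-1/2)), g(w₁)=0, g(w₂) large, k₁(w₁)=k large. *)

theory Defs
  imports "Jordan_Normal_Form.Matrix"
begin

text \<open>
  The coefficient functions are total functions of \<open>x = ((u, v), t)\<close>; only their values at
  points with \<open>t \<ge> 0\<close> are ever used.
\<close>

type_synonym point = "(real \<times> real) \<times> real"

definition arg_dom :: "point set" where
  "arg_dom = UNIV \<times> {0..}"

definition pos_semidef_nonsym :: "real mat \<Rightarrow> bool" where
  "pos_semidef_nonsym P \<longleftrightarrow> square_mat P \<and>
     (\<forall>\<xi> \<in> carrier_vec (dim_row P). \<xi> \<bullet> (P *\<^sub>v \<xi>) \<ge> 0)"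

definition pos_def_nonsym :: "real mat \<Rightarrow> bool" where
  "pos_def_nonsym P \<longleftrightarrow> square_mat P \<and>
     (\<forall>\<xi> \<in> carrier_vec (dim_row P). \<xi> \<noteq> 0\<^sub>v (dim_row P) \<longrightarrow> \<xi> \<bullet> (P *\<^sub>v \<xi>) > 0)"

definition pos_semidef :: "real mat \<Rightarrow> bool" where
  "pos_semidef P \<longleftrightarrow> P\<^sup>T = P \<and> pos_semidef_nonsym P"

definition pos_def :: "real mat \<Rightarrow> bool" where
  "pos_def P \<longleftrightarrow> P\<^sup>T = P \<and> pos_def_nonsym P"

definition euclidean_norm :: "real vec \<Rightarrow> real" where
  "euclidean_norm v = sqrt (v \<bullet> v)"

definition spectral_norm :: "real mat \<Rightarrow> real" where
  "spectral_norm A =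
     (SUP v \<in> {v \<in> carrier_vec (dim_col A). euclidean_norm v \<le> 1}. euclidean_norm (A *\<^sub>v v))"

definition problem_data :: "(point \<Rightarrow> real mat) \<Rightarrow> (point \<Rightarrow> real) \<Rightarrow> (point \<Rightarrow> real) \<Rightarrow> bool" where
  "problem_data D lam1 lam2 \<longleftrightarrow>
     (\<forall>x \<in> arg_dom. D x \<in> carrier_mat 2 2 \<and> 0 \<le> lam1 x \<and> 0 \<le> lam2 x) \<and>
     bdd_above (lam1 ` arg_dom) \<and> bdd_above (lam2 ` arg_dom)"

definition kfun :: "real \<Rightarrow> (point \<Rightarrow> real) \<Rightarrow> point \<Rightarrow> real" where
  "kfun r lam x = 1 + 1/2 * r * lam x"

text \<open>The entries \<open>d\<^sup>1, d\<^sup>2, d\<^sup>3, d\<^sup>4\<close> of \<open>D\<close> are listed row by row.\<close>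

definition cond_mat2 ::
    "real \<Rightarrow> (point \<Rightarrow> real mat) \<Rightarrow> (point \<Rightarrow> real) \<Rightarrow> (point \<Rightarrow> real) \<Rightarrow> point \<Rightarrow> real mat" where
  "cond_mat2 r D lam1 lam2 x =
     (let k1 = kfun r lam1 x; k2 = kfun r lam2 x; d1 = D x $$ (0,0); d2 = D x $$ (0,1) in
      mat_of_rows_list 2
        [[k1\<^sup>2 + 4 * r * (k1 - k2) * d1, 2 * r * (k1 - k2) * d2],
         [2 * r * (k1 - k2) * d2,       k2\<^sup>2]])"

definition cond_mat3 ::
    "real \<Rightarrow> (point \<Rightarrow> real mat) \<Rightarrow> (point \<Rightarrow> real) \<Rightarrow> (point \<Rightarrow> real) \<Rightarrow> point \<Rightarrow> real mat" where
  "cond_mat3 r D lam1 lam2 x =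
     (let k1 = kfun r lam1 x; k2 = kfun r lam2 x; d3 = D x $$ (1,0); d4 = D x $$ (1,1) in
      mat_of_rows_list 2
        [[k1\<^sup>2,                     2 * r * (k2 - k1) * d3],
         [2 * r * (k2 - k1) * d3,  k2\<^sup>2 + 4 * r * (k2 - k1) * d4]])"

text \<open>The predicate \<open>P\<close> is either \<^const>\<open>pos_semidef\<close> or \<^const>\<open>pos_def\<close>.\<close>

definition conditions ::
    "(real mat \<Rightarrow> bool) \<Rightarrow> real \<Rightarrow> (point \<Rightarrow> real mat) \<Rightarrow> (point \<Rightarrow> real) \<Rightarrow> (point \<Rightarrow> real) \<Rightarrow> bool" where
  "conditions P r D lam1 lam2 \<longleftrightarrow>
     (\<forall>x \<in> arg_dom. lam1 x = lam2 x) \<or>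
     (\<forall>x \<in> arg_dom. lam1 x > lam2 x \<and> P (cond_mat2 r D lam1 lam2 x)) \<or>
     (\<forall>x \<in> arg_dom. lam2 x > lam1 x \<and> P (cond_mat3 r D lam1 lam2 x)) \<or>
     ((\<exists>x \<in> arg_dom. lam1 x > lam2 x) \<and> (\<exists>x \<in> arg_dom. lam1 x < lam2 x) \<and>
      (\<forall>x \<in> arg_dom. P (cond_mat2 r D lam1 lam2 x) \<and> P (cond_mat3 r D lam1 lam2 x)))"

text \<open>
  Blocks are numbered from 1, matrix entries from 0. The superdiagonal block \<open>Up j\<close> sits in
  block row \<open>j\<close>, the subdiagonal block \<open>Lo j\<close> in block row \<open>j + 1\<close>.
\<close>

definition block_tridiag ::
    "nat \<Rightarrow> (nat \<Rightarrow> real mat) \<Rightarrow> (nat \<Rightarrow> real mat) \<Rightarrow> (nat \<Rightarrow> real mat) \<Rightarrow> real mat" where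
  "block_tridiag N Di Up Lo = mat (2 * N) (2 * N) (\<lambda>(i, k).
     let p = i div 2 + 1; q = k div 2 + 1; e = (i mod 2, k mod 2) in
     if q = p then Di p $$ e
     else if q = p + 1 then Up p $$ e
     else if p = q + 1 then Lo q $$ e
     else 0)"

text \<open>\<open>D_half D w t j\<close> is \<open>D\<^bsub>j+1/2\<^esub>\<close>.\<close>

definition D_half :: "(point \<Rightarrow> real mat) \<Rightarrow> (nat \<Rightarrow> real \<times> real) \<Rightarrow> real \<Rightarrow> nat \<Rightarrow> real mat" where
  "D_half D w t j = (1/2) \<cdot>\<^sub>m (D (w j, t) + D (w (j + 1), t))"

definition K_block ::
    "real \<Rightarrow> (point \<Rightarrow> real) \<Rightarrow> (point \<Rightarrow> real) \<Rightarrow> (nat \<Rightarrow> real \<times> real) \<Rightarrow> real \<Rightarrow> nat \<Rightarrow> real mat" where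
  "K_block r lam1 lam2 w t j =
     mat_of_rows_list 2 [[kfun r lam1 (w j, t), 0], [0, kfun r lam2 (w j, t)]]"

definition B_block ::
    "nat \<Rightarrow> real \<Rightarrow> (point \<Rightarrow> real mat) \<Rightarrow> (point \<Rightarrow> real) \<Rightarrow> (point \<Rightarrow> real) \<Rightarrow>
     (nat \<Rightarrow> real \<times> real) \<Rightarrow> real \<Rightarrow> nat \<Rightarrow> real mat" where
  "B_block N r D lam1 lam2 w t j = K_block r lam1 lam2 w t j +
     (if j = 1 then (2 * r) \<cdot>\<^sub>m D_half D w t 1
      else if j = N then (2 * r) \<cdot>\<^sub>m D_half D w t (N - 1)
      else r \<cdot>\<^sub>m (D_half D w t (j - 1) + D_half D w t j))"

definition U_block ::
    "real \<Rightarrow> (point \<Rightarrow> real mat) \<Rightarrow> (nat \<Rightarrow> real \<times> real) \<Rightarrow> real \<Rightarrow> nat \<Rightarrow> real mat" where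
  "U_block r D w t j = (if j = 1 then - (2 * r) else - r) \<cdot>\<^sub>m D_half D w t j"

definition L_block ::
    "nat \<Rightarrow> real \<Rightarrow> (point \<Rightarrow> real mat) \<Rightarrow> (nat \<Rightarrow> real \<times> real) \<Rightarrow> real \<Rightarrow> nat \<Rightarrow> real mat" where
  "L_block N r D w t j = (if j = N - 1 then - (2 * r) else - r) \<cdot>\<^sub>m D_half D w t j"

definition offdiag_nonzero ::
    "nat \<Rightarrow> real \<Rightarrow> (point \<Rightarrow> real mat) \<Rightarrow> (nat \<Rightarrow> real \<times> real) \<Rightarrow> real \<Rightarrow> bool" where
  "offdiag_nonzero N r D w t \<longleftrightarrow>
     (\<forall>j \<in> {1..N - 1}. U_block r D w t j \<noteq> 0\<^sub>m 2 2 \<and> L_block N r D w t j \<noteq> 0\<^sub>m 2 2)"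

definition block_LU ::
    "nat \<Rightarrow> (nat \<Rightarrow> real mat) \<Rightarrow> (nat \<Rightarrow> real mat) \<Rightarrow> (nat \<Rightarrow> real mat) \<Rightarrow>
     real mat \<Rightarrow> real mat \<Rightarrow> bool" where
  "block_LU N B Up Lo L U \<longleftrightarrow>
     (\<exists>Bbar Ubar.
        (\<forall>j \<in> {1..N}. Bbar j \<in> carrier_mat 2 2) \<and>
        (\<forall>j \<in> {1..N - 1}. Ubar j \<in> carrier_mat 2 2) \<and>
        L = block_tridiag N Bbar (\<lambda>_. 0\<^sub>m 2 2) Lo \<and>
        U = block_tridiag N (\<lambda>_. 1\<^sub>m 2) Ubar (\<lambda>_. 0\<^sub>m 2 2) \<and>
        block_tridiag N B Up Lo = L * U \<and>
        Bbar 1 = B 1 \<and>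
        (\<forall>j \<in> {1..N - 1}. Bbar j * Ubar j = Up j \<and> Bbar (j + 1) = B (j + 1) - Lo j * Ubar j))"

definition unique_stable_block_LU ::
    "real \<Rightarrow> nat \<Rightarrow> (nat \<Rightarrow> real mat) \<Rightarrow> (nat \<Rightarrow> real mat) \<Rightarrow> (nat \<Rightarrow> real mat) \<Rightarrow> bool" where
  "unique_stable_block_LU c N B Up Lo \<longleftrightarrow>
     (\<exists>L U. block_LU N B Up Lo L U \<and>
        spectral_norm L * spectral_norm U / spectral_norm (block_tridiag N B Up Lo) \<le> c \<and>
        (\<forall>L' U'. block_LU N B Up Lo L' U' \<longrightarrow> L' = L \<and> U' = U))"

text \<open>
  The bound \<open>f N\<close> is uniform in the node values, the time and the number \<open>N\<close> of nodes.
\<close>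

definition LU_stable_for ::
    "(nat \<Rightarrow> real) \<Rightarrow> real \<Rightarrow> (point \<Rightarrow> real mat) \<Rightarrow> (point \<Rightarrow> real) \<Rightarrow> (point \<Rightarrow> real) \<Rightarrow> bool" where
  "LU_stable_for f r D lam1 lam2 \<longleftrightarrow>
     (\<forall>N w t. 2 \<le> N \<longrightarrow> 0 \<le> t \<longrightarrow> offdiag_nonzero N r D w t \<longrightarrow>
        unique_stable_block_LU (f N) N
          (B_block N r D lam1 lam2 w t) (U_block r D w t) (L_block N r D w t))"

end

theory Submission
  imports Defs "Jordan_Normal_Form.Jordan_Normal_Form" "HOL-Analysis.L2_Norm"
begin

text \<open>
  The boundary rows of \<open>A\<close> carry a factor 2. After weighting them by 1/2, the matrix is the sum of
  the weighted reaction blocks \<open>K\<^sub>j\<close> on the diagonal and of a discrete diffusion with coupling matrices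
  \<open>G\<^sub>j = r D\<^bsub>j+1/2\<^esub>\<close> between the nodes \<open>j\<close> and \<open>j + 1\<close>. Block elimination then takes
  the form
  \<open>T\<^sub>1 = K\<^sub>1\<close>, \<open>(T\<^sub>j + G\<^sub>j) W\<^sub>j = G\<^sub>j\<close> and
  \<open>T\<^bsub>j+1\<^esub> = K\<^bsub>j+1\<^esub> + (G\<^sub>j - G\<^sub>j W\<^sub>j) = K\<^bsub>j+1\<^esub> + T\<^sub>j W\<^sub>j\<close>,
  where \<open>T\<^sub>j + G\<^sub>j\<close> is the weighted pivot and \<open>- W\<^sub>j\<close> the superdiagonal block of the factor \<open>U\<close>.

  Existence and uniqueness come from positivity alone: the quadratic form of \<open>T\<^sub>j W\<^sub>j\<close> is a sum
  of values of the forms of \<open>T\<^sub>j\<close> and \<open>G\<^sub>j\<close> (\<open>coercive_schur\<close>), so every \<open>T\<^sub>j\<close> stays at least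
  1/2, symmetric or not, and all pivots are invertible.

  For stability it is enough to bound the blocks \<open>W\<^sub>j\<close>
  (\<open>unique_stable_block_LU_if_bounded\<close>): every block of \<open>A\<close> is dominated by the norm of \<open>A\<close>, and a
  pivot differs from a diagonal block of \<open>A\<close> by the product of a subdiagonal block with some \<open>W\<^sub>j\<close>. The bound on \<open>W\<^sub>j\<close> has
  three sources.

  If \<open>G\<^sub>j = s M\<close> with \<open>M\<close> positive definite, then \<open>M\<close> itself controls \<open>W\<^sub>j\<close>
  uniformly in \<open>s\<close> and \<open>T\<^sub>j\<close> (\<open>norm_bound_schur_of_coercive_coupling\<close>). If \<open>M\<close> is singular, then
  all \<open>T\<^sub>j\<close> are diagonal up to a multiple of \<open>M\<close>, which makes \<open>W\<^sub>j\<close> explicit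
  (\<open>schur_singular_coupling\<close>). In both cases the bound depends on \<open>M\<close> only.

  For general \<open>D\<close> and small \<open>r\<close>, the entries of \<open>K\<^sub>j\<close> are at most 2. As
  \<open>(T\<^sub>j + G\<^sub>j) (1 - W\<^sub>j) = T\<^sub>j\<close>, the size of \<open>W\<^sub>j\<close> is governed by that of \<open>T\<^sub>j\<close>, and so is the
  size of \<open>T\<^bsub>j+1\<^esub>\<close> (\<open>norm_bound_schur_of_pivot_bound\<close>). This gives a bound that grows fast with the
  number of nodes but involves nothing else.
\<close>

section \<open>Spectral norm and entries\<close>

lemma abs_nth_le_euclidean_norm:
  assumes "i < dim_vec v"
  shows "\<bar>v $ i\<bar> \<le> euclidean_norm v"
proof -
  have "(v $ i)\<^sup>2 \<le> (\<Sum>k\<in>{0..<dim_vec v}. (v $ k)\<^sup>2)"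
    using assms by (intro member_le_sum) auto
  then have "sqrt ((v $ i)\<^sup>2) \<le> euclidean_norm v"
    by (simp only: euclidean_norm_def scalar_prod_def power2_eq_square real_sqrt_le_iff)
  then show ?thesis by simp
qed

lemma euclidean_norm_le_sum_abs: "euclidean_norm v \<le> (\<Sum>i<dim_vec v. \<bar>v $ i\<bar>)"
  using L2_set_le_sum_abs[of "\<lambda>i. v $ i" "{..<dim_vec v}"]
  by (simp add: L2_set_def euclidean_norm_def scalar_prod_def power2_eq_square lessThan_atLeast0)

lemma euclidean_norm_mult_vec_le:
  assumes A: "A \<in> carrier_mat n n" "norm_bound A c"
    and v: "v \<in> carrier_vec n" "euclidean_norm v \<le> 1"
  shows "euclidean_norm (A *\<^sub>v v) \<le> (real n)\<^sup>2 * c"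
proof -
  have "\<bar>(A *\<^sub>v v) $ i\<bar> \<le> real n * c" if i: "i < n" for i
  proof -
    have term_le: "\<bar>A $$ (i, k) * v $ k\<bar> \<le> c" if k: "k < n" for k
    proof -
      have "\<bar>A $$ (i, k)\<bar> \<le> c"
        using A i k by (auto simp: norm_bound_def)
      moreover have "\<bar>v $ k\<bar> \<le> 1"
        using abs_nth_le_euclidean_norm[of k v] v k by auto
      ultimately show ?thesis
        using mult_mono[of "\<bar>A $$ (i, k)\<bar>" c "\<bar>v $ k\<bar>" 1] by (simp add: abs_mult)
    qed
    have "(A *\<^sub>v v) $ i = (\<Sum>k<n. A $$ (i, k) * v $ k)"
      using A v i by (auto simp: scalar_prod_def lessThan_atLeast0)
    also have "\<bar>\<dots>\<bar> \<le> (\<Sum>k<n. c)"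
      by (rule order_trans[OF sum_abs sum_mono]) (use term_le in auto)
    finally show ?thesis by simp
  qed
  then have "(\<Sum>i<n. \<bar>(A *\<^sub>v v) $ i\<bar>) \<le> (\<Sum>i<n. real n * c)"
    by (intro sum_mono) auto
  then show ?thesis
    using euclidean_norm_le_sum_abs[of "A *\<^sub>v v"] A by (simp add: power2_eq_square)
qed

lemma spectral_norm_le:
  assumes A: "A \<in> carrier_mat n n" "norm_bound A c"
  shows "spectral_norm A \<le> (real n)\<^sup>2 * c"
  unfolding spectral_norm_def
proof (rule cSUP_least)
  have "0\<^sub>v n \<in> {v \<in> carrier_vec (dim_col A). euclidean_norm v \<le> 1}"
    using A by (simp add: euclidean_norm_def)
  then show "{v \<in> carrier_vec (dim_col A). euclidean_norm v \<le> 1} \<noteq> {}" by blast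
qed (use euclidean_norm_mult_vec_le[OF A] A in auto)

text \<open>
  Evaluating at unit vectors shows that the spectral norm dominates every entry. The supremum in
  its definition is of use only once it is known to be finite.
\<close>

lemma norm_bound_spectral_norm:
  assumes A: "A \<in> carrier_mat n n"
  shows "norm_bound A (spectral_norm A)"
proof
  fix i k assume "i < dim_row A" "k < dim_col A"
  then have ik: "i < n" "k < n" using A by auto
  let ?S = "{v \<in> carrier_vec (dim_col A). euclidean_norm v \<le> 1}"
  obtain c where c: "norm_bound A c" using norm_bound_max by blast
  have "bdd_above ((\<lambda>v. euclidean_norm (A *\<^sub>v v)) ` ?S)"
    using euclidean_norm_mult_vec_le[OF A c] A by (intro bdd_aboveI2[of _ _ "(real n)\<^sup>2 * c"]) auto
  moreover have "unit_vec n k \<in> ?S"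
    using A ik by (simp add: euclidean_norm_def)
  ultimately have "euclidean_norm (A *\<^sub>v unit_vec n k) \<le> spectral_norm A"
    unfolding spectral_norm_def by (intro cSUP_upper)
  moreover have "\<bar>(A *\<^sub>v unit_vec n k) $ i\<bar> \<le> euclidean_norm (A *\<^sub>v unit_vec n k)"
    using A ik by (intro abs_nth_le_euclidean_norm) auto
  moreover have "(A *\<^sub>v unit_vec n k) $ i = A $$ (i, k)"
    using A ik by simp
  ultimately show "norm (A $$ (i, k)) \<le> spectral_norm A" by simp
qed

lemma spectral_norm_nonneg:
  assumes "A \<in> carrier_mat n n" "0 < n"
  shows "0 \<le> spectral_norm A"
  using norm_bound_spectral_norm[OF assms(1)] assms
  by (fastforce simp: norm_bound_def intro: order_trans[OF norm_ge_zero])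

section \<open>Block bidiagonal factors of a block tridiagonal matrix\<close>

definition tridiag_block ::
    "(nat \<Rightarrow> real mat) \<Rightarrow> (nat \<Rightarrow> real mat) \<Rightarrow> (nat \<Rightarrow> real mat) \<Rightarrow> nat \<Rightarrow> nat \<Rightarrow> real mat" where
  "tridiag_block Di Up Lo p q =
     (if q = p then Di p else if q = p + 1 then Up p else if p = q + 1 then Lo q else 0\<^sub>m 2 2)"

lemma dim_block_tridiag [simp]:
  "dim_row (block_tridiag N Di Up Lo) = 2 * N"
  "dim_col (block_tridiag N Di Up Lo) = 2 * N"
  "block_tridiag N Di Up Lo \<in> carrier_mat (2 * N) (2 * N)"
  by (simp_all add: block_tridiag_def)

lemma block_tridiag_nth:
  assumes "p < N" "q < N" "a < 2" "b < 2"
  shows "block_tridiag N Di Up Lo $$ (2 * p + a, 2 * q + b) =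
         tridiag_block Di Up Lo (p + 1) (q + 1) $$ (a, b)"
proof -
  have "(2 * p + a) div 2 = p" "(2 * q + b) div 2 = q"
       "(2 * p + a) mod 2 = a" "(2 * q + b) mod 2 = b" "2 * p + a < 2 * N" "2 * q + b < 2 * N"
    using assms by auto
  then show ?thesis
    using assms by (simp add: block_tridiag_def tridiag_block_def Let_def)
qed

lemma all_less_double_iff:
  "(\<forall>i<2 * N. P i) \<longleftrightarrow> (\<forall>p<N. \<forall>a<2. P (2 * p + a))" for N :: nat
proof (intro iffI allI impI)
  fix i assume P: "\<forall>p<N. \<forall>a<2. P (2 * p + a)" and i: "i < 2 * N"
  then have "P (2 * (i div 2) + i mod 2)" by (intro P[rule_format]) auto
  then show "P i" by simp
qed auto

lemma sum_lessThan_double: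
  "(\<Sum>l<2 * N. h l) = (\<Sum>m<N. h (2 * m) + h (2 * m + 1))" for h :: "nat \<Rightarrow> real"
  by (induction N) (simp_all add: add.assoc)

lemma block_tridiag_eqI:
  assumes X: "X \<in> carrier_mat (2 * N) (2 * N)"
    and eq: "\<And>p q a b. p < N \<Longrightarrow> q < N \<Longrightarrow> a < 2 \<Longrightarrow> b < 2 \<Longrightarrow>
      tridiag_block Di Up Lo (p + 1) (q + 1) $$ (a, b) = X $$ (2 * p + a, 2 * q + b)"
  shows "block_tridiag N Di Up Lo = X"
proof (rule eq_matI)
  have "\<forall>i<2 * N. \<forall>k<2 * N. block_tridiag N Di Up Lo $$ (i, k) = X $$ (i, k)"
    unfolding all_less_double_iff using eq block_tridiag_nth by simp
  then show "block_tridiag N Di Up Lo $$ (i, k) = X $$ (i, k)"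
    if "i < dim_row X" "k < dim_col X" for i k using that X by auto
qed (use X in auto)

lemma block_tridiag_cong:
  assumes "\<And>j. j \<in> {1..N} \<Longrightarrow> Di j = Di' j"
    and "\<And>j. j \<in> {1..N - 1} \<Longrightarrow> Up j = Up' j"
    and "\<And>j. j \<in> {1..N - 1} \<Longrightarrow> Lo j = Lo' j"
  shows "block_tridiag N Di Up Lo = block_tridiag N Di' Up' Lo'"
proof (rule block_tridiag_eqI)
  fix p q a b :: nat assume pq: "p < N" "q < N" "a < 2" "b < 2"
  then have "tridiag_block Di Up Lo (p + 1) (q + 1) = tridiag_block Di' Up' Lo' (p + 1) (q + 1)"
    using assms by (auto simp: tridiag_block_def)
  then show "tridiag_block Di Up Lo (p + 1) (q + 1) $$ (a, b) =
      block_tridiag N Di' Up' Lo' $$ (2 * p + a, 2 * q + b)"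
    using pq by (simp add: block_tridiag_nth)
qed simp

lemma norm_bound_block_tridiag_iff:
  "norm_bound (block_tridiag N Di Up Lo) c \<longleftrightarrow>
    (\<forall>p<N. \<forall>q<N. \<forall>a<2. \<forall>b<2. \<bar>tridiag_block Di Up Lo (p + 1) (q + 1) $$ (a, b)\<bar> \<le> c)"
proof -
  have "norm_bound (block_tridiag N Di Up Lo) c \<longleftrightarrow>
      (\<forall>i<2 * N. \<forall>k<2 * N. \<bar>block_tridiag N Di Up Lo $$ (i, k)\<bar> \<le> c)"
    by (auto simp: norm_bound_def block_tridiag_def)
  also have "\<dots> \<longleftrightarrow> (\<forall>p<N. \<forall>a<2. \<forall>q<N. \<forall>b<2.
      \<bar>tridiag_block Di Up Lo (p + 1) (q + 1) $$ (a, b)\<bar> \<le> c)"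
    unfolding all_less_double_iff by (simp add: block_tridiag_nth)
  finally show ?thesis by blast
qed

lemma mult_2x2_nth:
  assumes "X \<in> carrier_mat 2 2" "Y \<in> carrier_mat 2 2" "a < 2" "b < 2"
  shows "(X * Y) $$ (a, b) = X $$ (a, 0) * Y $$ (0, b) + X $$ (a, 1) * Y $$ (1, b)"
  using assms by (simp add: scalar_prod_def numeral_2_eq_2)

text \<open>
  In the product of the two bidiagonal factors, block row \<open>p\<close> of the left one meets at most the
  block rows \<open>p\<close> and \<open>p - 1\<close> of the right one, which is why the recursion for the factors only
  couples neighbouring indices.
\<close>

lemma block_tridiag_eq_mult:
  assumes cL: "\<And>j. j \<in> {1..N} \<Longrightarrow> Bbar j \<in> carrier_mat 2 2"
    and cU: "\<And>j. j \<in> {1..N - 1} \<Longrightarrow> Ubar j \<in> carrier_mat 2 2"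
    and cLo: "\<And>j. j \<in> {1..N - 1} \<Longrightarrow> Lo j \<in> carrier_mat 2 2"
    and cB: "\<And>j. j \<in> {1..N} \<Longrightarrow> B j \<in> carrier_mat 2 2"
    and first: "Bbar 1 = B 1"
    and rec: "\<And>j. j \<in> {1..N - 1} \<Longrightarrow>
      Bbar j * Ubar j = Up j \<and> Bbar (j + 1) = B (j + 1) - Lo j * Ubar j"
  shows "block_tridiag N B Up Lo =
    block_tridiag N Bbar (\<lambda>_. 0\<^sub>m 2 2) Lo * block_tridiag N (\<lambda>_. 1\<^sub>m 2) Ubar (\<lambda>_. 0\<^sub>m 2 2)"
    (is "_ = ?L * ?U")
proof (rule block_tridiag_eqI)
  fix p q a b :: nat assume pq: "p < N" "q < N" and ab: "a < 2" "b < 2"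
  let ?l = "tridiag_block Bbar (\<lambda>_. 0\<^sub>m 2 2) Lo" and ?u = "tridiag_block (\<lambda>_. 1\<^sub>m 2) Ubar (\<lambda>_. 0\<^sub>m 2 2)"
  have lc: "?l (p + 1) (m + 1) \<in> carrier_mat 2 2" if "m < N" for m
    using cL cLo that pq by (auto simp: tridiag_block_def)
  have uc: "?u (m + 1) (q + 1) \<in> carrier_mat 2 2" if "m < N" for m
    using cU that pq by (auto simp: tridiag_block_def)
  have "(?L * ?U) $$ (2 * p + a, 2 * q + b) =
      (\<Sum>l<2 * N. ?L $$ (2 * p + a, l) * ?U $$ (l, 2 * q + b))"
    using pq ab by (subst index_mult_mat) (auto simp: scalar_prod_def lessThan_atLeast0)
  also have "\<dots> = (\<Sum>m<N. (?l (p + 1) (m + 1) * ?u (m + 1) (q + 1)) $$ (a, b))"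
  proof (subst sum_lessThan_double, intro sum.cong refl, unfold lessThan_iff)
    fix m assume m: "m < N"
    show "?L $$ (2 * p + a, 2 * m) * ?U $$ (2 * m, 2 * q + b) +
        ?L $$ (2 * p + a, 2 * m + 1) * ?U $$ (2 * m + 1, 2 * q + b) =
        (?l (p + 1) (m + 1) * ?u (m + 1) (q + 1)) $$ (a, b)"
      using block_tridiag_nth[OF pq(1) m ab(1), of 0] block_tridiag_nth[OF pq(1) m ab(1), of 1]
        block_tridiag_nth[OF m pq(2) _ ab(2), of 0] block_tridiag_nth[OF m pq(2) _ ab(2), of 1]
        mult_2x2_nth[OF lc[OF m] uc[OF m] ab]
      by simp
  qed
  also have "\<dots> = (\<Sum>m\<in>{m. m = p \<or> m + 1 = p}.
      (?l (p + 1) (m + 1) * ?u (m + 1) (q + 1)) $$ (a, b))"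
  proof (rule sum.mono_neutral_right)
    show "\<forall>m\<in>{..<N} - {m. m = p \<or> m + 1 = p}.
        (?l (p + 1) (m + 1) * ?u (m + 1) (q + 1)) $$ (a, b) = 0"
    proof
      fix m assume m: "m \<in> {..<N} - {m. m = p \<or> m + 1 = p}"
      then have "?l (p + 1) (m + 1) = 0\<^sub>m 2 2" by (auto simp: tridiag_block_def)
      then show "(?l (p + 1) (m + 1) * ?u (m + 1) (q + 1)) $$ (a, b) = 0"
        using uc[of m] m ab by simp
    qed
  qed (use pq in auto)
  also have "\<dots> = tridiag_block B Up Lo (p + 1) (q + 1) $$ (a, b)"
  proof (cases p)
    case 0
    have "{m. m = p \<or> m + 1 = p} = {0}" using 0 by auto
    then show ?thesis
      using rec[of 1] first cL[of 1] 0 pq ab by (auto simp: tridiag_block_def)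
  next
    case (Suc p')
    have set: "{m. m = p \<or> m + 1 = p} = {p', Suc p'}" using Suc by auto
    have c: "Bbar (Suc (Suc p')) \<in> carrier_mat 2 2" "Lo (Suc p') \<in> carrier_mat 2 2"
        "Ubar (Suc p') \<in> carrier_mat 2 2" "B (Suc (Suc p')) \<in> carrier_mat 2 2"
      using cL cLo cU cB pq Suc by auto
    have r: "Bbar (Suc (Suc p')) = B (Suc (Suc p')) - Lo (Suc p') * Ubar (Suc p')"
      using rec[of "Suc p'"] pq Suc by auto
    have r2: "Bbar (Suc (Suc p')) * Ubar (Suc (Suc p')) = Up (Suc (Suc p'))" if "Suc (Suc p') < N"
      using rec[of "Suc (Suc p')"] that Suc by auto
    have k: "q = p \<or> q = Suc p \<or> Suc q = p \<or> (q \<noteq> p \<and> q \<noteq> Suc p \<and> Suc q \<noteq> p)" by blast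
    have sum: "(\<Sum>m\<in>{p', Suc p'}. f m) = f p' + f (Suc p')" for f :: "nat \<Rightarrow> real" by simp
    show ?thesis unfolding set sum
      using k c r2 pq ab Suc
      by (elim disjE) (auto simp: tridiag_block_def r simp del: index_mult_mat(1))
  qed
  finally show "tridiag_block B Up Lo (p + 1) (q + 1) $$ (a, b) = (?L * ?U) $$ (2 * p + a, 2 * q + b)"
    by simp
qed (rule mult_carrier_mat[of _ _ "2 * N"]; simp)

section \<open>Existence, uniqueness and stability of the factorization\<close>

lemma inverse_of_det:
  fixes S :: "real mat"
  assumes S: "S \<in> carrier_mat n n" and det: "det S \<noteq> 0"
  obtains R where "R \<in> carrier_mat n n" "R * S = 1\<^sub>m n" "S * R = 1\<^sub>m n"
proof
  show "(1 / det S) \<cdot>\<^sub>m adj_mat S \<in> carrier_mat n n" using adj_mat[OF S] by simp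
  show "(1 / det S) \<cdot>\<^sub>m adj_mat S * S = 1\<^sub>m n" "S * ((1 / det S) \<cdot>\<^sub>m adj_mat S) = 1\<^sub>m n"
    using adj_mat[OF S] S det by (auto simp: mult_smult_distrib[OF S] mult_smult_assoc_mat)
qed

lemma mult_left_cancel_of_det:
  fixes S :: "real mat"
  assumes "S \<in> carrier_mat n n" "det S \<noteq> 0"
    and "X \<in> carrier_mat n m" "Y \<in> carrier_mat n m" "S * X = S * Y"
  shows "X = Y"
proof -
  obtain R where R: "R \<in> carrier_mat n n" "R * S = 1\<^sub>m n"
    using inverse_of_det[OF assms(1,2)] by blast
  have "R * (S * Z) = Z" if "Z \<in> carrier_mat n m" for Z
    using assoc_mult_mat[OF R(1) assms(1) that] R that by simp
  then show ?thesis using assms by metis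
qed

definition ratio_bound :: "real \<Rightarrow> nat \<Rightarrow> real" where
  "ratio_bound C N = 16 * real N ^ 4 * (1 + 2 * C) * C"

text \<open>
  The recursion for the factors never inverts the last pivot \<open>Bbar N\<close>, so only the first
  \<open>N - 1\<close> pivots have to be nonsingular. Stability reduces to a bound on the blocks \<open>Ubar j\<close>: all
  blocks of \<open>A\<close> are dominated by its norm, and \<open>Bbar (j + 1) = B (j + 1) - Lo j * Ubar j\<close> then is
  so too up to the factor \<open>1 + 2 * C\<close>. The power of \<open>N\<close> is the price of passing between the
  spectral norm and the largest entry.
\<close>

lemma unique_stable_block_LU_if_bounded:
  assumes N: "1 \<le> N"
    and cB: "\<And>j. j \<in> {1..N} \<Longrightarrow> B j \<in> carrier_mat 2 2"
    and cLo: "\<And>j. j \<in> {1..N - 1} \<Longrightarrow> Lo j \<in> carrier_mat 2 2"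
    and cL: "\<And>j. j \<in> {1..N} \<Longrightarrow> Bbar j \<in> carrier_mat 2 2"
    and cU: "\<And>j. j \<in> {1..N - 1} \<Longrightarrow> Ubar j \<in> carrier_mat 2 2"
    and first: "Bbar 1 = B 1"
    and rec: "\<And>j. j \<in> {1..N - 1} \<Longrightarrow>
      Bbar j * Ubar j = Up j \<and> Bbar (j + 1) = B (j + 1) - Lo j * Ubar j"
    and det: "\<And>j. j \<in> {1..N - 1} \<Longrightarrow> det (Bbar j) \<noteq> 0"
    and bound: "\<And>j. j \<in> {1..N - 1} \<Longrightarrow> norm_bound (Ubar j) C"
    and C: "1 \<le> C"
  shows "unique_stable_block_LU (ratio_bound C N) N B Up Lo"
proof -
  let ?L = "block_tridiag N Bbar (\<lambda>_. 0\<^sub>m 2 2) Lo"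
  let ?U = "block_tridiag N (\<lambda>_. 1\<^sub>m 2) Ubar (\<lambda>_. 0\<^sub>m 2 2)"
  let ?A = "block_tridiag N B Up Lo"
  have LU: "block_LU N B Up Lo ?L ?U"
    unfolding block_LU_def
    using block_tridiag_eq_mult[OF cL cU cLo cB first rec] cL cU first rec
    by (intro exI[of _ Bbar] exI[of _ Ubar] conjI ballI) simp_all
  have unique: "L' = ?L \<and> U' = ?U" if LU': "block_LU N B Up Lo L' U'" for L' U'
  proof -
    obtain Bbar' Ubar' where cL': "\<forall>j\<in>{1..N}. Bbar' j \<in> carrier_mat 2 2"
      and cU': "\<forall>j\<in>{1..N - 1}. Ubar' j \<in> carrier_mat 2 2"
      and L': "L' = block_tridiag N Bbar' (\<lambda>_. 0\<^sub>m 2 2) Lo"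
      and U': "U' = block_tridiag N (\<lambda>_. 1\<^sub>m 2) Ubar' (\<lambda>_. 0\<^sub>m 2 2)"
      and first': "Bbar' 1 = B 1"
      and rec': "\<forall>j\<in>{1..N - 1}. Bbar' j * Ubar' j = Up j \<and>
        Bbar' (j + 1) = B (j + 1) - Lo j * Ubar' j"
      using LU' unfolding block_LU_def by (elim exE conjE) (rule that; assumption)
    have Ubar_eq: "Ubar' j = Ubar j" if "j \<in> {1..N - 1}" "Bbar' j = Bbar j" for j
    proof (rule mult_left_cancel_of_det)
      show "Bbar j \<in> carrier_mat 2 2" using cL that by auto
      show "Bbar j * Ubar' j = Bbar j * Ubar j" using rec[OF that(1)] rec'[rule_format, OF that(1)] that(2) by simp
    qed (use that cU cU' det in auto)
    have Bbar_eq: "Bbar' (Suc i) = Bbar (Suc i)" if "Suc i \<le> N" for i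
      using that
    proof (induction i)
      case (Suc i)
      then have "Ubar' (Suc i) = Ubar (Suc i)" by (intro Ubar_eq) auto
      then show ?case using Suc.prems rec[of "Suc i"] rec'[rule_format, of "Suc i"] by auto
    qed (use first first' in auto)
    have Bbar_eq': "Bbar' j = Bbar j" if "j \<in> {1..N}" for j
      using Bbar_eq[of "j - 1"] that by auto
    then have "Ubar' j = Ubar j" if "j \<in> {1..N - 1}" for j
      using Ubar_eq that by auto
    then show ?thesis
      unfolding L' U' using Bbar_eq' by (auto intro!: block_tridiag_cong)
  qed
  define a where "a = spectral_norm ?A"
  have a: "0 \<le> a" unfolding a_def using N by (intro spectral_norm_nonneg[of _ "2 * N"]) auto
  have A_le: "\<bar>tridiag_block B Up Lo (p + 1) (q + 1) $$ (e, e')\<bar> \<le> a"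
    if "p < N" "q < N" "e < 2" "e' < 2" for p q e e'
    using norm_bound_spectral_norm[of ?A "2 * N"] that
    by (auto simp: norm_bound_block_tridiag_iff a_def)
  have B_le: "\<bar>B (Suc p) $$ (e, e')\<bar> \<le> a" if "p < N" "e < 2" "e' < 2" for p e e'
    using A_le[of p p e e'] that by (simp add: tridiag_block_def)
  have Lo_le: "\<bar>Lo (Suc p) $$ (e, e')\<bar> \<le> a" if "Suc p < N" "e < 2" "e' < 2" for p e e'
    using A_le[of "Suc p" p e e'] that by (simp add: tridiag_block_def)
  have grow: "a \<le> a * (1 + 2 * C)" using mult_left_mono[of 1 "1 + 2 * C" a] a C by simp
  have Bbar_le: "\<bar>Bbar (Suc p) $$ (e, e')\<bar> \<le> a * (1 + 2 * C)"
    if p: "p < N" and e: "e < 2" "e' < 2" for p e e'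
  proof (cases p)
    case 0
    then show ?thesis using first B_le[OF p e] grow by simp
  next
    case (Suc i)
    have i: "Suc i \<in> {1..N - 1}" using p Suc by auto
    have "norm_bound (Lo (Suc i) * Ubar (Suc i)) (a * C * of_nat 2)"
      using cLo[OF i] cU[OF i] bound[OF i] Lo_le[of i] p Suc
      by (intro norm_bound_mult) (auto simp: norm_bound_def)
    then have "\<bar>(Lo (Suc i) * Ubar (Suc i)) $$ (e, e')\<bar> \<le> a * C * 2"
      using cLo[OF i] cU[OF i] e by (auto simp: norm_bound_def)
    moreover have "Bbar (Suc p) $$ (e, e') =
        B (Suc p) $$ (e, e') - (Lo (Suc i) * Ubar (Suc i)) $$ (e, e')"
      using rec[OF i] cLo[OF i] cU[OF i] e Suc by simp
    ultimately show ?thesis using B_le[OF p e] by (simp add: algebra_simps)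
  qed
  have "norm_bound ?L (a * (1 + 2 * C))"
    unfolding norm_bound_block_tridiag_iff
  proof (intro allI impI)
    fix p q e e' :: nat assume pq: "p < N" "q < N" and e: "e < 2" "e' < 2"
    show "\<bar>tridiag_block Bbar (\<lambda>_. 0\<^sub>m 2 2) Lo (p + 1) (q + 1) $$ (e, e')\<bar> \<le> a * (1 + 2 * C)"
      using Bbar_le[OF pq(1) e] Lo_le[of q, OF _ e] order_trans[OF _ grow] a grow e pq
      by (auto simp: tridiag_block_def)
  qed
  then have L_le: "spectral_norm ?L \<le> (2 * real N)\<^sup>2 * (a * (1 + 2 * C))"
    using spectral_norm_le[of ?L "2 * N"] by simp
  have "norm_bound ?U C"
    unfolding norm_bound_block_tridiag_iff
  proof (intro allI impI)
    fix p q e e' :: nat assume pq: "p < N" "q < N" and e: "e < 2" "e' < 2"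
    have "\<bar>Ubar (Suc p) $$ (e, e')\<bar> \<le> C" if "Suc p < N"
    proof -
      have j: "Suc p \<in> {1..N - 1}" using that by auto
      show ?thesis using bound[OF j] cU[OF j] e by (auto simp: norm_bound_def)
    qed
    then show "\<bar>tridiag_block (\<lambda>_. 1\<^sub>m 2) Ubar (\<lambda>_. 0\<^sub>m 2 2) (p + 1) (q + 1) $$ (e, e')\<bar> \<le> C"
      using C e pq by (auto simp: tridiag_block_def)
  qed
  then have U_le: "spectral_norm ?U \<le> (2 * real N)\<^sup>2 * C"
    using spectral_norm_le[of ?U "2 * N"] by simp
  have "spectral_norm ?L * spectral_norm ?U \<le>
      ((2 * real N)\<^sup>2 * (a * (1 + 2 * C))) * ((2 * real N)\<^sup>2 * C)"
    using a C N spectral_norm_nonneg[of ?U "2 * N"] by (intro mult_mono[OF L_le U_le]) auto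
  also have "\<dots> = (16 * real N ^ 4 * (1 + 2 * C) * C) * a"
    by (simp add: power_mult_distrib power4_eq_xxxx power2_eq_square)
  finally have "spectral_norm ?L * spectral_norm ?U / spectral_norm ?A \<le> ratio_bound C N"
    using a C N by (cases "a = 0") (auto simp: ratio_bound_def a_def[symmetric] divide_simps)
  with LU unique show ?thesis unfolding unique_stable_block_LU_def by blast
qed

section \<open>Coercive matrices and Schur complements\<close>

definition coercive :: "real \<Rightarrow> real mat \<Rightarrow> bool" where
  "coercive \<mu> P \<longleftrightarrow> (\<forall>x \<in> carrier_vec (dim_row P). \<mu> * (x \<bullet> x) \<le> x \<bullet> (P *\<^sub>v x))"

lemma coerciveD:
  "coercive \<mu> P \<Longrightarrow> P \<in> carrier_mat n n \<Longrightarrow> x \<in> carrier_vec n \<Longrightarrow> \<mu> * (x \<bullet> x) \<le> x \<bullet> (P *\<^sub>v x)"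
  by (auto simp: coercive_def)

lemma coercive_add:
  assumes "A \<in> carrier_mat n n" "B \<in> carrier_mat n n" "coercive \<mu> A" "coercive \<nu> B"
  shows "coercive (\<mu> + \<nu>) (A + B)"
  unfolding coercive_def
proof
  fix x :: "real vec" assume "x \<in> carrier_vec (dim_row (A + B))"
  then have x: "x \<in> carrier_vec n" using assms by auto
  have "x \<bullet> ((A + B) *\<^sub>v x) = x \<bullet> (A *\<^sub>v x) + x \<bullet> (B *\<^sub>v x)"
    using assms x by (simp add: add_mult_distrib_mat_vec[of _ n n] scalar_prod_add_distrib[of _ n])
  then show "(\<mu> + \<nu>) * (x \<bullet> x) \<le> x \<bullet> ((A + B) *\<^sub>v x)"
    using coerciveD[OF assms(3,1) x] coerciveD[OF assms(4,2) x] by (simp add: distrib_right)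
qed

lemma smult_mat_mult_vec:
  fixes A :: "real mat"
  assumes "A \<in> carrier_mat n m" "x \<in> carrier_vec m"
  shows "(s \<cdot>\<^sub>m A) *\<^sub>v x = s \<cdot>\<^sub>v (A *\<^sub>v x)"
  using assms by (intro eq_vecI) auto

lemma coercive_smult:
  assumes A: "A \<in> carrier_mat n n" "coercive \<mu> A" and s: "0 \<le> s"
  shows "coercive (s * \<mu>) (s \<cdot>\<^sub>m A)"
  unfolding coercive_def
proof
  fix x :: "real vec" assume "x \<in> carrier_vec (dim_row (s \<cdot>\<^sub>m A))"
  then have x: "x \<in> carrier_vec n" using A by auto
  have "x \<bullet> ((s \<cdot>\<^sub>m A) *\<^sub>v x) = s * (x \<bullet> (A *\<^sub>v x))"
    using A x by (simp add: smult_mat_mult_vec[of _ n n])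
  then show "s * \<mu> * (x \<bullet> x) \<le> x \<bullet> ((s \<cdot>\<^sub>m A) *\<^sub>v x)"
    using mult_left_mono[OF coerciveD[OF A(2,1) x] s] by (simp add: mult.assoc)
qed

lemma coercive_det_nonzero:
  assumes S: "S \<in> carrier_mat n n" "coercive \<mu> S" and \<mu>: "0 < \<mu>"
  shows "det S \<noteq> 0"
proof
  assume "det S = 0"
  then obtain x where x: "x \<in> carrier_vec n" "x \<noteq> 0\<^sub>v n" "S *\<^sub>v x = 0\<^sub>v n"
    using det_0_iff_vec_prod_zero[OF S(1)] by blast
  have "\<mu> * (x \<bullet> x) \<le> 0" using coerciveD[OF S(2,1) x(1)] x by simp
  then have "x \<bullet> x \<le> 0" using \<mu> by (simp add: mult_le_0_iff)
  moreover have "x \<bullet> x > 0"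
  proof -
    obtain i where i: "i < n" "x $ i \<noteq> 0" using x by (metis carrier_vecD dim_vec_last eq_vecI index_zero_vec)
    then have "0 < (x $ i)\<^sup>2" by simp
    also have "\<dots> \<le> (\<Sum>k\<in>{0..<n}. (x $ k)\<^sup>2)" using i by (intro member_le_sum) auto
    finally show ?thesis using x by (simp add: scalar_prod_def power2_eq_square)
  qed
  ultimately show False by simp
qed

text \<open>
  This is how coercivity turns into a bound, and it replaces the Cauchy-Schwarz inequality:
  expand \<open>0 \<le> (\<mu> y - t) \<bullet> (\<mu> y - t)\<close>.
\<close>

lemma norm_sq_le_of_coercive:
  fixes y t :: "real vec"
  assumes yt: "y \<in> carrier_vec n" "t \<in> carrier_vec n" and \<mu>: "0 \<le> \<mu>"
    and le: "\<mu> * (y \<bullet> y) \<le> y \<bullet> t"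
  shows "\<mu>\<^sup>2 * (y \<bullet> y) \<le> t \<bullet> t"
proof -
  have "0 \<le> (\<Sum>i\<in>{0..<n}. (\<mu> * y $ i - t $ i)\<^sup>2)" by (intro sum_nonneg) auto
  also have "\<dots> = \<mu>\<^sup>2 * (y \<bullet> y) - 2 * (\<mu> * (y \<bullet> t)) + t \<bullet> t"
    using yt by (simp add: scalar_prod_def sum_distrib_left power2_eq_square algebra_simps
        sum.distrib sum_subtractf)
  finally show ?thesis
    using mult_left_mono[OF le \<mu>] by (simp add: power2_eq_square)
qed

text \<open>
  Columnwise use of the previous lemma. The factor \<open>n\<close> comes from bounding the length of a column
  of \<open>T\<close> by its largest entry.
\<close>

lemma norm_bound_of_columns:
  assumes Y: "Y \<in> carrier_mat n n" and T: "T \<in> carrier_mat n n" "norm_bound T c" and \<mu>: "0 < \<mu>"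
    and col: "\<And>k. k < n \<Longrightarrow> \<mu> * (col Y k \<bullet> col Y k) \<le> col Y k \<bullet> col T k"
  shows "norm_bound Y (real n * c / \<mu>)"
proof
  fix i k assume "i < dim_row Y" "k < dim_col Y"
  then have ik: "i < n" "k < n" using Y by auto
  have T_le: "\<bar>T $$ (i, k)\<bar> \<le> c" if "i < n" for i using T that ik by (auto simp: norm_bound_def)
  then have c: "0 \<le> c" using ik by force
  have "(\<mu> * Y $$ (i, k))\<^sup>2 \<le> \<mu>\<^sup>2 * (\<Sum>l\<in>{0..<n}. (Y $$ (l, k))\<^sup>2)"
    unfolding power_mult_distrib using ik by (intro mult_left_mono member_le_sum) auto
  also have "\<dots> = \<mu>\<^sup>2 * (col Y k \<bullet> col Y k)"
    using Y ik by (simp add: scalar_prod_def power2_eq_square)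
  also have "\<dots> \<le> col T k \<bullet> col T k"
    using Y T ik \<mu> col by (intro norm_sq_le_of_coercive[of _ n]) auto
  also have "\<dots> = (\<Sum>l\<in>{0..<n}. (T $$ (l, k))\<^sup>2)"
    using T ik by (simp add: scalar_prod_def power2_eq_square)
  also have "\<dots> \<le> (\<Sum>l\<in>{0..<n}. c\<^sup>2)"
    using T_le by (intro sum_mono) (metis abs_le_square_iff abs_of_nonneg atLeastLessThan_iff c)
  also have "\<dots> \<le> (real n * c)\<^sup>2"
  proof -
    have "real n \<le> (real n)\<^sup>2" using ik by (simp add: power2_eq_square)
    then show ?thesis by (simp add: power_mult_distrib mult_right_mono)
  qed
  finally have "\<bar>\<mu> * Y $$ (i, k)\<bar> \<le> real n * c"
    using c by (metis abs_le_square_iff abs_of_nonneg mult_nonneg_nonneg of_nat_0_le_iff)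
  then show "norm (Y $$ (i, k)) \<le> real n * c / \<mu>"
    using \<mu> by (simp add: abs_mult field_simps)
qed

lemma schur_complement_eq:
  fixes T G W :: "real mat"
  assumes "T \<in> carrier_mat n n" "G \<in> carrier_mat n n" "W \<in> carrier_mat n n" "(T + G) * W = G"
  shows "T * W = G - G * W"
proof (rule eq_matI)
  have sum: "T * W + G * W = G"
    using assms add_mult_distrib_mat[OF assms(1,2,3)] by simp
  fix i k assume "i < dim_row (G - G * W)" "k < dim_col (G - G * W)"
  then have ik: "i < n" "k < n" using assms by auto
  have "(T * W) $$ (i, k) + (G * W) $$ (i, k) = (T * W + G * W) $$ (i, k)"
    using assms(1-3) ik by (subst index_add_mat(1)) simp_all
  then show "(T * W) $$ (i, k) = (G - G * W) $$ (i, k)"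
    unfolding sum using assms(1-3) ik by (subst index_minus_mat(1)) simp_all
qed (use assms in auto)

text \<open>
  Passing to the Schur complement \<open>G - G * W = T * W\<close> preserves positive semi-definiteness without
  any symmetry: for \<open>z = W x\<close> and \<open>e = x - z\<close> one has \<open>T z = G e\<close>, hence
  \<open>x \<bullet> T z = z \<bullet> T z + e \<bullet> G e\<close>.
\<close>

lemma coercive_schur:
  assumes T: "T \<in> carrier_mat n n" "coercive 0 T" and G: "G \<in> carrier_mat n n" "coercive 0 G"
    and W: "W \<in> carrier_mat n n" "(T + G) * W = G"
  shows "coercive 0 (T * W)"
  unfolding coercive_def
proof
  fix x :: "real vec" assume "x \<in> carrier_vec (dim_row (T * W))"
  then have x: "x \<in> carrier_vec n" using T by auto
  define z where "z = W *\<^sub>v x"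
  define e where "e = x - z"
  have z: "z \<in> carrier_vec n" using W x by (simp add: z_def)
  have e: "e \<in> carrier_vec n" using x z by (simp add: e_def)
  have TW: "(T * W) *\<^sub>v x = T *\<^sub>v z" using T W x by (simp add: z_def)
  have "(T * W) *\<^sub>v x = (G - G * W) *\<^sub>v x" using schur_complement_eq[OF T(1) G(1) W] by simp
  also have "\<dots> = G *\<^sub>v e"
    using G W x z by (simp add: e_def z_def minus_mult_distrib_mat_vec[of _ n n]
        mult_minus_distrib_mat_vec[of _ n n])
  finally have Te: "T *\<^sub>v z = G *\<^sub>v e" using TW by simp
  have "x = z + e" using x z by (auto simp: e_def)
  then have "x \<bullet> (T *\<^sub>v z) = z \<bullet> (T *\<^sub>v z) + e \<bullet> (G *\<^sub>v e)"
    using add_scalar_prod_distrib[OF z e, of "G *\<^sub>v e"] G e Te by simp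
  then show "0 * (x \<bullet> x) \<le> x \<bullet> ((T * W) *\<^sub>v x)"
    using coerciveD[OF T(2,1) z] coerciveD[OF G(2,1) e] TW by simp
qed

section \<open>The recursion for the difference scheme\<close>

text \<open>
  These weights undo the factor 2 in the boundary rows. They make the blocks in positions
  \<open>(j, j + 1)\<close> and \<open>(j + 1, j)\<close> equal, both to \<open>- r \<cdot>\<^sub>m D_half D w t j\<close>.
\<close>

definition weight :: "nat \<Rightarrow> nat \<Rightarrow> real" where
  "weight N j = (if j = 1 \<or> j = N then 1 / 2 else 1)"

text \<open>
  The recursion never breaks down, since coercivity of \<open>T j\<close> makes \<open>T j + G j\<close> invertible and is
  inherited by \<open>T (j + 1)\<close>. The part \<open>T j\<close> is the pivot without its coupling \<open>G j\<close> to the next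
  node. The invariant \<open>Q\<close> is a parameter because each class of cross-diffusion
  matrices needs its own knowledge of \<open>T j\<close> to bound \<open>W j\<close>.
\<close>

lemma schur_sequences:
  fixes K G :: "nat \<Rightarrow> real mat"
  assumes K: "\<And>j. j \<in> {1..N} \<Longrightarrow> K j \<in> carrier_mat n n \<and> coercive \<mu> (K j)" and \<mu>: "0 < \<mu>"
    and G: "\<And>j. j \<in> {1..N - 1} \<Longrightarrow> G j \<in> carrier_mat n n \<and> coercive 0 (G j)"
    and base: "Q 1 (K 1)"
    and step: "\<And>j T W. j \<in> {1..N - 1} \<Longrightarrow> T \<in> carrier_mat n n \<Longrightarrow> coercive \<mu> T \<Longrightarrow> Q j T \<Longrightarrow>
      W \<in> carrier_mat n n \<Longrightarrow> (T + G j) * W = G j \<Longrightarrow>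
      norm_bound W C \<and> Q (j + 1) (K (j + 1) + T * W)"
    and N: "1 \<le> N"
  shows "\<exists>T W. T 1 = K 1 \<and> (\<forall>j \<in> {1..N}. T j \<in> carrier_mat n n) \<and>
    (\<forall>j \<in> {1..N - 1}. W j \<in> carrier_mat n n \<and> (T j + G j) * W j = G j \<and>
      det (T j + G j) \<noteq> 0 \<and> norm_bound (W j) C \<and> T (j + 1) = K (j + 1) + T j * W j)"
proof -
  define sol where "sol T j = (SOME W. W \<in> carrier_mat n n \<and> (T + G j) * W = G j)" for T j
  \<comment> \<open>The value of \<open>T\<close> at 0 is a dummy.\<close>
  define T where "T = rec_nat (K 1) (\<lambda>j T. if j = 0 then K 1 else K (Suc j) + T * sol T j)"
  define W where "W j = sol (T j) j" for j
  have T1: "T (Suc 0) = K 1" by (simp add: T_def)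
  have T_Suc: "T (Suc j) = K (Suc j) + T j * W j" if "j \<noteq> 0" for j
    using that by (simp add: T_def W_def)
  have coercive_0: "coercive 0 T" if "coercive \<mu> T" for T :: "real mat"
    unfolding coercive_def
  proof
    fix x :: "real vec" assume x: "x \<in> carrier_vec (dim_row T)"
    have "0 \<le> x \<bullet> x" by (simp add: scalar_prod_def sum_nonneg)
    then have "0 \<le> \<mu> * (x \<bullet> x)" using \<mu> by simp
    then show "0 * (x \<bullet> x) \<le> x \<bullet> (T *\<^sub>v x)" using that x by (force simp: coercive_def)
  qed
  have S: "T + G j \<in> carrier_mat n n \<and> det (T + G j) \<noteq> 0"
    if "j \<in> {1..N - 1}" "T \<in> carrier_mat n n" "coercive \<mu> T" for T j
    using coercive_det_nonzero[of _ n, OF _ coercive_add[of T n "G j" \<mu> 0]] that G[OF that(1)] \<mu> by auto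
  have sol: "sol T j \<in> carrier_mat n n \<and> (T + G j) * sol T j = G j"
    if j: "j \<in> {1..N - 1}" and T: "T \<in> carrier_mat n n" "coercive \<mu> T" for T j
  proof -
    obtain R where R: "R \<in> carrier_mat n n" "(T + G j) * R = 1\<^sub>m n"
      using inverse_of_det S[OF j T] by blast
    have Gj: "G j \<in> carrier_mat n n" using G[OF j] by simp
    have "(T + G j) * (R * G j) = (T + G j) * R * G j"
      using S[OF j T] R(1) Gj by (intro assoc_mult_mat[symmetric]) auto
    also have "\<dots> = G j" unfolding R(2) using Gj by simp
    finally have "R * G j \<in> carrier_mat n n \<and> (T + G j) * (R * G j) = G j"
      using R(1) Gj by simp
    then show ?thesis unfolding sol_def by (rule someI)
  qed
  have inv: "T (Suc i) \<in> carrier_mat n n \<and> coercive \<mu> (T (Suc i)) \<and> Q (Suc i) (T (Suc i))"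
    if "Suc i \<le> N" for i
    using that
  proof (induction i)
    case 0
    then show ?case using K[of 1] base T1 by simp
  next
    case (Suc i)
    then have i: "Suc i \<in> {1..N - 1}" "Suc (Suc i) \<in> {1..N}" by auto
    have IH: "T (Suc i) \<in> carrier_mat n n" "coercive \<mu> (T (Suc i))" "Q (Suc i) (T (Suc i))"
      using Suc by auto
    have W: "W (Suc i) \<in> carrier_mat n n" "(T (Suc i) + G (Suc i)) * W (Suc i) = G (Suc i)"
      using sol[OF i(1) IH(1,2)] by (simp_all add: W_def)
    have "coercive 0 (T (Suc i) * W (Suc i))"
      using coercive_schur[OF IH(1) coercive_0[OF IH(2)] _ _ W] G[OF i(1)] by blast
    then have "coercive \<mu> (K (Suc (Suc i)) + T (Suc i) * W (Suc i))"
      using coercive_add[of "K (Suc (Suc i))" n "T (Suc i) * W (Suc i)" \<mu> 0] K[OF i(2)] IH W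
      by simp
    then show ?case
      using step[OF i(1) IH W] K[OF i(2)] IH W by (simp add: T_Suc)
  qed
  have inv': "T j \<in> carrier_mat n n \<and> coercive \<mu> (T j) \<and> Q j (T j)" if "j \<in> {1..N}" for j
    using inv[of "j - 1"] that by auto
  have carrier: "\<forall>j \<in> {1..N}. T j \<in> carrier_mat n n" using inv' by simp
  have rec: "\<forall>j \<in> {1..N - 1}. W j \<in> carrier_mat n n \<and> (T j + G j) * W j = G j \<and>
      det (T j + G j) \<noteq> 0 \<and> norm_bound (W j) C \<and> T (j + 1) = K (j + 1) + T j * W j"
  proof
    fix j assume j: "j \<in> {1..N - 1}"
    have T: "T j \<in> carrier_mat n n" "coercive \<mu> (T j)" "Q j (T j)" using inv'[of j] j by auto
    have W: "W j \<in> carrier_mat n n" "(T j + G j) * W j = G j"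
      using sol[OF j T(1,2)] by (simp_all add: W_def)
    show "W j \<in> carrier_mat n n \<and> (T j + G j) * W j = G j \<and>
        det (T j + G j) \<noteq> 0 \<and> norm_bound (W j) C \<and> T (j + 1) = K (j + 1) + T j * W j"
      using W S[OF j T(1,2)] step[OF j T W] T_Suc[of j] j by simp
  qed
  show ?thesis by (intro exI[of _ T] exI[of _ W] conjI carrier rec) (simp add: T1)
qed

lemma smult_mult_uminus:
  fixes A B :: "real mat"
  assumes "A \<in> carrier_mat n m" "B \<in> carrier_mat m k"
  shows "(s \<cdot>\<^sub>m A) * (- B) = (- s) \<cdot>\<^sub>m (A * B)"
  using assms by (intro eq_matI) (auto simp: scalar_prod_def sum_distrib_left sum_negf mult.assoc)

text \<open>
  The weights are undone here: the factors of the original matrix have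
  pivots \<open>(T j + G j) / weight N j\<close> for \<open>j < N\<close> and \<open>T N / weight N N\<close>, and superdiagonal
  blocks \<open>- W j\<close>.
\<close>

lemma scheme_unique_stable:
  fixes N r lam1 lam2 w t D
  defines "K \<equiv> \<lambda>j. weight N j \<cdot>\<^sub>m K_block r lam1 lam2 w t j"
    and "G \<equiv> \<lambda>j. r \<cdot>\<^sub>m D_half D w t j"
  assumes N: "2 \<le> N" and C: "1 \<le> C"
    and K: "\<And>j. j \<in> {1..N} \<Longrightarrow> coercive (1 / 2) (K j)"
    and G: "\<And>j. j \<in> {1..N - 1} \<Longrightarrow> G j \<in> carrier_mat 2 2 \<and> coercive 0 (G j)"
    and base: "Q 1 (K 1)"
    and step: "\<And>j T W. j \<in> {1..N - 1} \<Longrightarrow> T \<in> carrier_mat 2 2 \<Longrightarrow> coercive (1 / 2) T \<Longrightarrow> Q j T \<Longrightarrow>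
      W \<in> carrier_mat 2 2 \<Longrightarrow> (T + G j) * W = G j \<Longrightarrow>
      norm_bound W C \<and> Q (j + 1) (K (j + 1) + T * W)"
  shows "unique_stable_block_LU (ratio_bound C N) N
    (B_block N r D lam1 lam2 w t) (U_block r D w t) (L_block N r D w t)"
proof -
  let ?K = "K_block r lam1 lam2 w t" and ?D = "D_half D w t"
  let ?B = "B_block N r D lam1 lam2 w t" and ?U = "U_block r D w t" and ?L = "L_block N r D w t"
  have cKb [simp]: "?K j \<in> carrier_mat 2 2" for j
    by (auto simp: K_block_def mat_of_rows_list_def)
  note [simp] = carrier_matD[OF cKb]
  have cK: "K j \<in> carrier_mat 2 2" for j by (simp add: K_def)
  have cD: "?D j \<in> carrier_mat 2 2" if "j \<in> {1..N - 1}" for j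
    using carrier_matD[OF conjunct1[OF G[OF that]]] by (intro carrier_matI) (simp_all add: G_def)
  have "\<exists>T W. T 1 = K 1 \<and> (\<forall>j \<in> {1..N}. T j \<in> carrier_mat 2 2) \<and>
    (\<forall>j \<in> {1..N - 1}. W j \<in> carrier_mat 2 2 \<and> (T j + G j) * W j = G j \<and>
      det (T j + G j) \<noteq> 0 \<and> norm_bound (W j) C \<and> T (j + 1) = K (j + 1) + T j * W j)"
  proof (rule schur_sequences[where \<mu> = "1 / 2" and Q = Q])
    show "K j \<in> carrier_mat 2 2 \<and> coercive (1 / 2) (K j)" if "j \<in> {1..N}" for j
      using cK K[OF that] by simp
    show "0 < (1 / 2 :: real)" "1 \<le> N" using N by simp_all
  qed (fact G base step)+
  then obtain T W where T1: "T 1 = K 1" and cT': "\<forall>j \<in> {1..N}. T j \<in> carrier_mat 2 2"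
    and TW': "\<forall>j \<in> {1..N - 1}. W j \<in> carrier_mat 2 2 \<and> (T j + G j) * W j = G j \<and>
      det (T j + G j) \<noteq> 0 \<and> norm_bound (W j) C \<and> T (j + 1) = K (j + 1) + T j * W j"
    by (elim exE conjE) (rule that)
  note cT = bspec[OF cT'] and TW = bspec[OF TW']
  have weight_pos: "0 < weight N j" for j by (simp add: weight_def)
  define S where "S j = (if j = N then T j else T j + G j)" for j
  have cS: "S j \<in> carrier_mat 2 2" if "j \<in> {1..N}" for j
    using cT[OF that] G[of j] that by (auto simp: S_def)
  have B_eq: "?B j = ?K j + (1 / weight N j) \<cdot>\<^sub>m
      ((if j = 1 then 0\<^sub>m 2 2 else G (j - 1)) + (if j = N then 0\<^sub>m 2 2 else G j))"
    if j: "j \<in> {1..N}" for j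
  proof -
    consider "j = 1" | "j = N" "j \<noteq> 1" | "j \<noteq> 1" "j \<noteq> N" by blast
    then show ?thesis
    proof cases
      case 1
      then show ?thesis using N cD[of 1] by (auto simp: B_block_def weight_def G_def intro!: eq_matI)
    next
      case 2
      then show ?thesis using N cD[of "N - 1"]
        by (auto simp: B_block_def weight_def G_def intro!: eq_matI)
    next
      case 3
      then have "j - 1 \<in> {1..N - 1}" "j \<in> {1..N - 1}" using j by auto
      from this[THEN cD] show ?thesis using 3
        by (auto simp: B_block_def weight_def G_def distrib_left intro!: eq_matI)
    qed
  qed
  have U_eq: "?U j = (- (1 / weight N j)) \<cdot>\<^sub>m G j" if "j \<in> {1..N - 1}" for j
    using that cD[OF that] by (auto simp: U_block_def weight_def G_def intro!: eq_matI)
  have L_eq: "?L j = (- (1 / weight N (j + 1))) \<cdot>\<^sub>m G j" if "j \<in> {1..N - 1}" for j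
    using that cD[OF that] by (auto simp: L_block_def weight_def G_def intro!: eq_matI)
  show ?thesis
  proof (rule unique_stable_block_LU_if_bounded
      [where Bbar = "\<lambda>j. (1 / weight N j) \<cdot>\<^sub>m S j" and Ubar = "\<lambda>j. - W j"])
    show "1 \<le> N" "1 \<le> C" using N C by auto
    show "?B j \<in> carrier_mat 2 2" if "j \<in> {1..N}" for j
      using G[of "j - 1"] G[of j] that by (subst B_eq[OF that]) (auto intro!: add_carrier_mat)
    show "?L j \<in> carrier_mat 2 2" if "j \<in> {1..N - 1}" for j using that cD by (simp add: L_block_def)
    show "(1 / weight N j) \<cdot>\<^sub>m S j \<in> carrier_mat 2 2" if "j \<in> {1..N}" for j
      using cS[OF that] by simp
    show "- W j \<in> carrier_mat 2 2" if "j \<in> {1..N - 1}" for j using TW[OF that] by simp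
    show "(1 / weight N 1) \<cdot>\<^sub>m S 1 = ?B 1"
    proof -
      have "?B 1 = ?K 1 + (1 / weight N 1) \<cdot>\<^sub>m (0\<^sub>m 2 2 + G 1)"
        using B_eq[of 1] N by simp
      moreover have "S 1 = weight N 1 \<cdot>\<^sub>m ?K 1 + G 1" using N T1 by (simp add: S_def K_def)
      moreover have "G 1 \<in> carrier_mat 2 2" using G[of 1] N by auto
      ultimately show ?thesis
        using weight_pos[of 1] by (auto intro!: eq_matI simp: field_simps)
    qed
    fix j assume j: "j \<in> {1..N - 1}"
    note TWj = TW[OF j] and Gj = G[OF j]
    have Sj: "S j = T j + G j" using j by (auto simp: S_def)
    have cSj: "S j \<in> carrier_mat 2 2" using cS j by auto
    show "det ((1 / weight N j) \<cdot>\<^sub>m S j) \<noteq> 0"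
      using TWj Sj cSj weight_pos[of j] by (simp add: det_smult)
    show "norm_bound (- W j) C" using TWj by (simp add: norm_bound_def)
    show "(1 / weight N j) \<cdot>\<^sub>m S j * - W j = ?U j \<and>
      (1 / weight N (j + 1)) \<cdot>\<^sub>m S (j + 1) = ?B (j + 1) - ?L j * - W j"
    proof
      have cW: "W j \<in> carrier_mat 2 2" using TWj by simp
      show "(1 / weight N j) \<cdot>\<^sub>m S j * - W j = ?U j"
        unfolding smult_mult_uminus[OF cSj cW] U_eq[OF j] using TWj Sj by simp
      define X where "X = G j * W j"
      have cX: "X \<in> carrier_mat 2 2" using TWj Gj by (auto simp: X_def)
      have LW: "?L j * - W j = (1 / weight N (j + 1)) \<cdot>\<^sub>m X"
        unfolding L_eq[OF j] X_def smult_mult_uminus[OF conjunct1[OF Gj] cW] by simp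
      have "T j * W j = G j - X"
        unfolding X_def using TWj Gj cT[of j] j by (intro schur_complement_eq[of _ 2]) auto
      then have Tn: "T (j + 1) = weight N (j + 1) \<cdot>\<^sub>m ?K (j + 1) + (G j - X)"
        using TWj by (simp add: K_def)
      have Bn: "?B (j + 1) = ?K (j + 1) + (1 / weight N (j + 1)) \<cdot>\<^sub>m
          (G j + (if j + 1 = N then 0\<^sub>m 2 2 else G (j + 1)))"
        using B_eq[of "j + 1"] j by auto
      have w: "weight N (Suc j) \<noteq> 0" using weight_pos[of "Suc j"] by simp
      show "(1 / weight N (j + 1)) \<cdot>\<^sub>m S (j + 1) = ?B (j + 1) - ?L j * - W j"
      proof (cases "j + 1 = N")
        case True
        then show ?thesis
          unfolding LW Bn S_def Tn using Gj cX w
          by (auto intro!: eq_matI simp: field_simps)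
      next
        case False
        then have "G (Suc j) \<in> carrier_mat 2 2" using G[of "Suc j"] j by auto
        then show ?thesis
          using False unfolding LW Bn S_def Tn using Gj cX w
          by (auto intro!: eq_matI simp: field_simps)
      qed
    qed
  qed
qed

section \<open>Bounds for the superdiagonal blocks\<close>

text \<open>
  A bound that depends on \<open>T\<close> alone, however large \<open>G\<close> is: by \<open>(T + G) (1 - W) = T\<close> the
  matrix \<open>1 - W\<close> is controlled by \<open>T\<close> and by the coercivity of \<open>T + G\<close>, which \<open>G\<close> can
  only improve. It also controls the next pivot part, through \<open>T * W\<close>.
\<close>

lemma norm_bound_schur_of_pivot_bound:
  assumes T: "T \<in> carrier_mat 2 2" "coercive (1 / 2) T" "norm_bound T c"
    and G: "G \<in> carrier_mat 2 2" "coercive 0 G"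
    and W: "W \<in> carrier_mat 2 2" "(T + G) * W = G"
  shows "norm_bound W (1 + 4 * c)" "norm_bound (T * W) (2 * c * (1 + 4 * c))"
proof -
  let ?Y = "1\<^sub>m 2 - W"
  have Y: "?Y \<in> carrier_mat 2 2" using W by auto
  have S: "T + G \<in> carrier_mat 2 2" "coercive (1 / 2) (T + G)"
    using T G coercive_add[of T 2 G "1 / 2" 0] by auto
  have "(T + G) * ?Y = (T + G) - G"
    using mult_minus_distrib_mat[OF S(1) one_carrier_mat W(1)] W(2) right_mult_one_mat[OF S(1)]
    by simp
  also have "\<dots> = T" using T G by (intro eq_matI) auto
  finally have SY: "(T + G) * ?Y = T" .
  have bound_Y: "norm_bound ?Y (real 2 * c / (1 / 2))"
  proof (rule norm_bound_of_columns[OF Y T(1,3)])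
    fix k :: nat assume k: "k < 2"
    have "(T + G) *\<^sub>v col ?Y k = col T k"
      using SY col_mult2[OF S(1) Y k] by simp
    moreover have "col ?Y k \<in> carrier_vec 2" using W(1) by (intro carrier_vecI) simp
    ultimately show "1 / 2 * (col ?Y k \<bullet> col ?Y k) \<le> col ?Y k \<bullet> col T k"
      using coerciveD[OF S(2,1), of "col ?Y k"] by simp
  qed simp
  show W_le: "norm_bound W (1 + 4 * c)"
  proof
    fix i k assume "i < dim_row W" "k < dim_col W"
    then have ik: "i < 2" "k < 2" using W by auto
    then have "\<bar>?Y $$ (i, k)\<bar> \<le> 4 * c" using bound_Y W by (simp add: norm_bound_def)
    then show "norm (W $$ (i, k)) \<le> 1 + 4 * c"
      using ik W by (cases "i = k") (auto simp: abs_le_iff)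
  qed
  show "norm_bound (T * W) (2 * c * (1 + 4 * c))"
    using norm_bound_mult[OF T(1) W(1) T(3) W_le] by (simp add: mult_ac)
qed

text \<open>
  A bound that depends on \<open>G\<close> alone, and not on its size: if \<open>G = s M\<close>, then testing
  \<open>(T + s M) y = s M x\<close> with \<open>y\<close> gives \<open>s \<mu> (y \<bullet> y) \<le> s (y \<bullet> M x)\<close>, and \<open>s\<close> cancels.
\<close>

lemma norm_bound_schur_of_coercive_coupling:
  assumes T: "T \<in> carrier_mat n n" "coercive \<nu> T" "0 < \<nu>"
    and M: "M \<in> carrier_mat n n" "coercive \<mu> M" "0 < \<mu>" "norm_bound M m" and s: "0 \<le> s"
    and W: "W \<in> carrier_mat n n" "(T + s \<cdot>\<^sub>m M) * W = s \<cdot>\<^sub>m M"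
  shows "norm_bound W (real n * m / \<mu>)"
proof (rule norm_bound_of_columns[OF W(1) M(1,4,3)])
  fix k assume k: "k < n"
  let ?y = "col W k"
  have y: "?y \<in> carrier_vec n" using W by auto
  have sM: "s \<cdot>\<^sub>m M \<in> carrier_mat n n" "T + s \<cdot>\<^sub>m M \<in> carrier_mat n n" using M T by auto
  have "(T + s \<cdot>\<^sub>m M) *\<^sub>v ?y = s \<cdot>\<^sub>v col M k"
    using col_mult2[OF sM(2) W(1) k] W(2) M k by simp
  moreover have "coercive (\<nu> + s * \<mu>) (T + s \<cdot>\<^sub>m M)"
    by (rule coercive_add[OF T(1) sM(1) T(2) coercive_smult[OF M(1,2) s]])
  ultimately have le: "(\<nu> + s * \<mu>) * (?y \<bullet> ?y) \<le> s * (?y \<bullet> col M k)"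
    using coerciveD[OF _ sM(2) y] y M by fastforce
  have yy: "0 \<le> ?y \<bullet> ?y" by (simp add: scalar_prod_def sum_nonneg)
  show "\<mu> * (?y \<bullet> ?y) \<le> ?y \<bullet> col M k"
  proof (cases "s = 0")
    \<comment> \<open>Nothing can be cancelled, but the coercivity of \<open>T\<close> forces \<open>W = 0\<close>.\<close>
    case True
    then have "?y \<bullet> ?y = 0" using le yy T(3) by (simp add: mult_le_0_iff)
    moreover have "0 \<le> ?y \<bullet> col M k"
    proof -
      have "?y $ i = 0" if "i < n" for i
      proof -
        have "(?y $ i)\<^sup>2 \<le> (\<Sum>l\<in>{0..<n}. (?y $ l)\<^sup>2)" using that by (intro member_le_sum) auto
        also have "\<dots> = 0" using \<open>?y \<bullet> ?y = 0\<close> W(1) by (simp add: scalar_prod_def power2_eq_square)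
        finally show ?thesis by simp
      qed
      then show ?thesis using M y by (simp add: scalar_prod_def)
    qed
    ultimately show ?thesis by simp
  next
    case False
    have "0 \<le> \<nu> * (?y \<bullet> ?y)" using yy T(3) by simp
    then have "s * (\<mu> * (?y \<bullet> ?y)) \<le> s * (?y \<bullet> col M k)" using le by (simp add: algebra_simps)
    then show ?thesis using False s by (simp add: mult_le_cancel_left)
  qed
qed

definition mat2 :: "real \<Rightarrow> real \<Rightarrow> real \<Rightarrow> real \<Rightarrow> real mat" where
  "mat2 a b c d = mat_of_rows_list 2 [[a, b], [c, d]]"

lemma mat2_carrier [simp]:
  "mat2 a b c d \<in> carrier_mat 2 2" "dim_row (mat2 a b c d) = 2" "dim_col (mat2 a b c d) = 2"
  by (simp_all add: mat2_def mat_of_rows_list_def numeral_2_eq_2)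

lemma mat2_nth [simp]:
  "mat2 a b c d $$ (0, 0) = a" "mat2 a b c d $$ (0, Suc 0) = b"
  "mat2 a b c d $$ (Suc 0, 0) = c" "mat2 a b c d $$ (Suc 0, Suc 0) = d"
  by (simp_all add: mat2_def mat_of_rows_list_def numeral_2_eq_2)

lemma mat_eq_mat2:
  "P \<in> carrier_mat 2 2 \<Longrightarrow> P = mat2 (P $$ (0, 0)) (P $$ (0, 1)) (P $$ (1, 0)) (P $$ (1, 1))"
  by (rule eq_matI) (auto simp: numeral_2_eq_2 less_Suc_eq)

lemma mat2_arith:
  "mat2 a b c d + mat2 a' b' c' d' = mat2 (a + a') (b + b') (c + c') (d + d')"
  "mat2 a b c d - mat2 a' b' c' d' = mat2 (a - a') (b - b') (c - c') (d - d')"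
  "s \<cdot>\<^sub>m mat2 a b c d = mat2 (s * a) (s * b) (s * c) (s * d)"
  "mat2 a b c d * mat2 a' b' c' d' =
    mat2 (a * a' + b * c') (a * b' + b * d') (c * a' + d * c') (c * b' + d * d')"
  by (rule eq_matI; auto simp: numeral_2_eq_2 less_Suc_eq scalar_prod_def)+

lemma norm_bound_mat2_iff:
  "norm_bound (mat2 a b c d) m \<longleftrightarrow> \<bar>a\<bar> \<le> m \<and> \<bar>b\<bar> \<le> m \<and> \<bar>c\<bar> \<le> m \<and> \<bar>d\<bar> \<le> m"
  unfolding norm_bound_def by (auto simp: numeral_2_eq_2 less_Suc_eq)

lemma coercive_mat2_iff:
  "coercive \<mu> (mat2 a b c d) \<longleftrightarrow>
    (\<forall>x y. \<mu> * (x * x + y * y) \<le> x * (a * x + b * y) + y * (c * x + d * y))"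
proof (intro iffI allI)
  fix x y :: real assume "coercive \<mu> (mat2 a b c d)"
  from coerciveD[OF this mat2_carrier(1), of "vec 2 (\<lambda>i. if i = 0 then x else y)"]
  show "\<mu> * (x * x + y * y) \<le> x * (a * x + b * y) + y * (c * x + d * y)"
    by (simp add: scalar_prod_def numeral_2_eq_2)
qed (auto simp: coercive_def scalar_prod_def numeral_2_eq_2)

text \<open>The smaller eigenvalue is at least the determinant over the trace.\<close>

lemma coercive_of_det_pos:
  assumes "0 < a + d" "0 < a * d - b * b"
  shows "coercive ((a * d - b * b) / (a + d)) (mat2 a b b d)"
  unfolding coercive_mat2_iff
proof (intro allI)
  fix x y
  have "(a + d) * (x * (a * x + b * y) + y * (b * x + d * y)) - (a * d - b * b) * (x * x + y * y)
      = (a * x + b * y)\<^sup>2 + (b * x + d * y)\<^sup>2"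
    by (simp add: power2_eq_square algebra_simps)
  then have "(a * d - b * b) * (x * x + y * y) \<le> (a + d) * (x * (a * x + b * y) + y * (b * x + d * y))"
    by (smt (verit) zero_le_power2)
  then show "(a * d - b * b) / (a + d) * (x * x + y * y) \<le> x * (a * x + b * y) + y * (b * x + d * y)"
    using assms by (simp add: field_simps)
qed

lemma psd_mat2_cases:
  assumes "coercive 0 (mat2 a b b d)"
  obtains "0 \<le> a" "0 \<le> d" "a * d = b * b" | \<mu> where "0 < \<mu>" "coercive \<mu> (mat2 a b b d)"
proof -
  have psd: "0 \<le> x * (a * x + b * y) + y * (b * x + d * y)" for x y
    using assms by (simp add: coercive_mat2_iff)
  have a: "0 \<le> a" and d: "0 \<le> d" using psd[of 1 0] psd[of 0 1] by auto
  have "0 \<le> d * (a * d - b * b)" using psd[of d "- b"] by (simp add: algebra_simps)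
  moreover have "0 \<le> a * (a * d - b * b)" using psd[of "- b" a] by (simp add: algebra_simps)
  moreover have "b = 0" if "a = 0" "d = 0" using psd[of 1 1] psd[of 1 "-1"] that by simp
  ultimately have "a * d - b * b = 0 \<or> 0 < a * d - b * b \<and> 0 < a + d"
    using a d by (smt (verit) mult_eq_0_iff zero_le_mult_iff)
  then show thesis
  proof
    assume "a * d - b * b = 0"
    then show thesis using that(1) a d by simp
  next
    assume "0 < a * d - b * b \<and> 0 < a + d"
    then show thesis using that(2)[OF _ coercive_of_det_pos] by simp
  qed
qed

text \<open>
  For singular \<open>M\<close> and \<open>K = diag(a, b)\<close> the matrix \<open>W\<close> is a multiple of \<open>adj(K) M\<close>, and
  \<open>M adj(K) M\<close> is a multiple of \<open>M\<close>; so the form "diagonal plus multiple of \<open>M\<close>" persists. The ratio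
  of \<open>a\<close> to \<open>b\<close> is arbitrary, but its effect on \<open>W\<close> is limited by the angles between the range
  of \<open>M\<close> and the coordinate axes, which is what \<open>C\<close> measures.
\<close>

lemma schur_singular_coupling:
  fixes m1 m2 m4 s c a b C :: real
  defines "M \<equiv> mat2 m1 m2 m2 m4"
  assumes M: "0 \<le> m1" "0 \<le> m4" "m1 * m4 = m2 * m2"
    and C: "1 \<le> C" "\<bar>m2\<bar> \<le> C * m1" "\<bar>m2\<bar> \<le> C * m4"
    and pos: "0 < a" "0 < b" "0 \<le> c" "0 \<le> s"
    and T: "T = mat2 a 0 0 b + c \<cdot>\<^sub>m M" and W: "W \<in> carrier_mat 2 2" "(T + s \<cdot>\<^sub>m M) * W = s \<cdot>\<^sub>m M"
    and det: "det (T + s \<cdot>\<^sub>m M) \<noteq> 0"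
  shows "norm_bound W C" "\<exists>c'\<ge>0. T * W = c' \<cdot>\<^sub>m M"
proof -
  define \<tau> where "\<tau> = b * m1 + a * m4"
  define \<Delta> where "\<Delta> = a * b + (c + s) * \<tau>"
  have \<tau>: "0 \<le> \<tau>" using M pos by (simp add: \<tau>_def)
  have "s * \<tau> \<le> (c + s) * \<tau>" using pos \<tau> by (intro mult_right_mono) auto
  moreover have "0 < a * b" using pos by simp
  moreover have "0 \<le> s * \<tau>" using pos \<tau> by simp
  ultimately have \<Delta>: "0 < \<Delta>" "s * \<tau> \<le> \<Delta>" unfolding \<Delta>_def by linarith+
  define X where "X = mat2 (b * m1) (b * m2) (a * m2) (a * m4)"
  have cM: "M \<in> carrier_mat 2 2" and cX: "X \<in> carrier_mat 2 2" and cT: "T \<in> carrier_mat 2 2"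
    by (simp_all add: M_def X_def T)
  then have cS: "T + s \<cdot>\<^sub>m M \<in> carrier_mat 2 2" by simp
  have SX: "(T + s \<cdot>\<^sub>m M) * X = \<Delta> \<cdot>\<^sub>m M"
  proof -
    have zero: "m2 * m2 - m1 * m4 = 0" using M(3) by simp
    have "(a + c * m1 + s * m1) * (b * m1) + (c * m2 + s * m2) * (a * m2) =
        \<Delta> * m1 + (c + s) * a * (m2 * m2 - m1 * m4)"
      by (simp add: \<Delta>_def \<tau>_def algebra_simps)
    moreover have "(a + c * m1 + s * m1) * (b * m2) + (c * m2 + s * m2) * (a * m4) = \<Delta> * m2"
      by (simp add: \<Delta>_def \<tau>_def algebra_simps)
    moreover have "(c * m2 + s * m2) * (b * m1) + (b + c * m4 + s * m4) * (a * m2) = \<Delta> * m2"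
      by (simp add: \<Delta>_def \<tau>_def algebra_simps)
    moreover have "(c * m2 + s * m2) * (b * m2) + (b + c * m4 + s * m4) * (a * m4) =
        \<Delta> * m4 + (c + s) * b * (m2 * m2 - m1 * m4)"
      by (simp add: \<Delta>_def \<tau>_def algebra_simps)
    ultimately show ?thesis
      unfolding zero by (simp add: T M_def X_def mat2_arith)
  qed
  have "(T + s \<cdot>\<^sub>m M) * ((s / \<Delta>) \<cdot>\<^sub>m X) = (s / \<Delta>) \<cdot>\<^sub>m (\<Delta> \<cdot>\<^sub>m M)"
    unfolding mult_smult_distrib[OF cS cX] SX ..
  also have "\<dots> = s \<cdot>\<^sub>m M" using \<Delta>(1) by (simp add: M_def mat2_arith)
  finally have W_eq: "W = (s / \<Delta>) \<cdot>\<^sub>m X"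
    using mult_left_cancel_of_det[OF cS det W(1), of "(s / \<Delta>) \<cdot>\<^sub>m X"] W(2) cX by simp
  have entry: "\<bar>s / \<Delta> * x\<bar> \<le> C" if "\<bar>x\<bar> \<le> C * \<tau>" for x
  proof -
    have "s * \<bar>x\<bar> \<le> C * (s * \<tau>)" using mult_left_mono[OF that pos(4)] by (simp add: mult_ac)
    also have "\<dots> \<le> C * \<Delta>" using \<Delta>(2) C(1) by (intro mult_left_mono) auto
    finally show ?thesis using \<Delta>(1) pos by (simp add: abs_mult field_simps)
  qed
  have "b * m1 \<le> \<tau>" "a * m4 \<le> \<tau>" using M pos by (simp_all add: \<tau>_def)
  then have "C * (b * m1) \<le> C * \<tau>" "C * (a * m4) \<le> C * \<tau>"
    using C(1) by (simp_all add: mult_left_mono)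
  moreover have "b * m1 \<le> C * (b * m1)" "a * m4 \<le> C * (a * m4)"
    using mult_right_mono[OF C(1), of "b * m1"] mult_right_mono[OF C(1), of "a * m4"] M pos
    by simp_all
  moreover have "b * \<bar>m2\<bar> \<le> C * (b * m1)" "a * \<bar>m2\<bar> \<le> C * (a * m4)"
    using mult_left_mono[OF C(2), of b] mult_left_mono[OF C(3), of a] pos by (simp_all add: mult_ac)
  moreover have "\<bar>b * m1\<bar> = b * m1" "\<bar>a * m4\<bar> = a * m4"
      "\<bar>b * m2\<bar> = b * \<bar>m2\<bar>" "\<bar>a * m2\<bar> = a * \<bar>m2\<bar>"
    using M pos by (simp_all add: abs_mult)
  ultimately have "\<bar>b * m1\<bar> \<le> C * \<tau>" "\<bar>b * m2\<bar> \<le> C * \<tau>" "\<bar>a * m2\<bar> \<le> C * \<tau>" "\<bar>a * m4\<bar> \<le> C * \<tau>"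
    by linarith+
  from this[THEN entry] show "norm_bound W C"
    unfolding W_eq X_def mat2_arith(3) norm_bound_mat2_iff by blast
  have "T * W = s \<cdot>\<^sub>m M - s \<cdot>\<^sub>m M * W"
    using cM by (intro schur_complement_eq[OF cT _ W]) simp
  also have "\<dots> = (s * (1 - s * \<tau> / \<Delta>)) \<cdot>\<^sub>m M"
  proof -
    have "m1 * (b * m1) + m2 * (a * m2) = \<tau> * m1" "m1 * (b * m2) + m2 * (a * m4) = \<tau> * m2"
         "m2 * (b * m1) + m4 * (a * m2) = \<tau> * m2" "m2 * (b * m2) + m4 * (a * m4) = \<tau> * m4"
      using M(3) by (simp_all add: \<tau>_def algebra_simps)
    then have "M * X = \<tau> \<cdot>\<^sub>m M"
      by (simp add: M_def X_def mat2_arith)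
    then have "M * W = (s / \<Delta>) \<cdot>\<^sub>m (\<tau> \<cdot>\<^sub>m M)"
      unfolding W_eq mult_smult_distrib[OF cM cX] by (rule arg_cong)
    then have "s \<cdot>\<^sub>m M * W = s \<cdot>\<^sub>m ((s / \<Delta>) \<cdot>\<^sub>m (\<tau> \<cdot>\<^sub>m M))"
      unfolding mult_smult_assoc_mat[OF cM W(1)] by (rule arg_cong)
    then show ?thesis by (simp add: M_def mat2_arith right_diff_distrib mult_ac)
  qed
  finally have "T * W = (s * (1 - s * \<tau> / \<Delta>)) \<cdot>\<^sub>m M" .
  moreover have "0 \<le> s * (1 - s * \<tau> / \<Delta>)" using pos \<Delta> by simp
  ultimately show "\<exists>c'\<ge>0. T * W = c' \<cdot>\<^sub>m M" by blast
qed

section \<open>The two classes of cross-diffusion matrices\<close>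

lemma K_block_eq_mat2:
  "K_block r lam1 lam2 w t j = mat2 (kfun r lam1 (w j, t)) 0 0 (kfun r lam2 (w j, t))"
  by (simp add: K_block_def mat2_def)

lemma weight_bounds: "1 / 2 \<le> weight N j" "weight N j \<le> 1"
  by (simp_all add: weight_def)

lemma node_in_arg_dom: "0 \<le> t \<Longrightarrow> (w j, t) \<in> arg_dom"
  by (simp add: arg_dom_def)

lemma kfun_ge_1:
  assumes "problem_data D lam1 lam2" "0 < r" "x \<in> arg_dom"
  shows "1 \<le> kfun r lam1 x" "1 \<le> kfun r lam2 x"
  using assms by (auto simp: problem_data_def kfun_def)

lemma coercive_weighted_K_block:
  assumes "problem_data D lam1 lam2" "0 < r" "0 \<le> t"
  shows "coercive (1 / 2) (weight N j \<cdot>\<^sub>m K_block r lam1 lam2 w t j)"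
proof -
  let ?k1 = "kfun r lam1 (w j, t)" and ?k2 = "kfun r lam2 (w j, t)"
  have scale: "1 / 2 * (x * x) \<le> weight N j * k * (x * x)" if "1 \<le> k" for x k
  proof -
    have "1 / 2 \<le> weight N j * k"
      using mult_mono[of "1 / 2" "weight N j" 1 k] that weight_bounds(1)[of N j] by simp
    then show ?thesis by (intro mult_right_mono) simp_all
  qed
  have "1 / 2 * (x * x) \<le> weight N j * ?k1 * (x * x)"
      "1 / 2 * (x * x) \<le> weight N j * ?k2 * (x * x)" for x :: real
    by (rule scale; rule kfun_ge_1[OF assms(1,2) node_in_arg_dom[OF assms(3)]])+
  then have "1 / 2 * (x * x + y * y) \<le> x * (weight N j * ?k1 * x) + y * (weight N j * ?k2 * y)" for x y
    using add_mono[of "1 / 2 * (x * x)" "weight N j * ?k1 * (x * x)"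
        "1 / 2 * (y * y)" "weight N j * ?k2 * (y * y)"] by (simp add: algebra_simps)
  then show ?thesis by (simp add: K_block_eq_mat2 mat2_arith coercive_mat2_iff)
qed

lemma coercive_of_pos_semidef_nonsym: "pos_semidef_nonsym P \<Longrightarrow> coercive 0 P"
  by (simp add: pos_semidef_nonsym_def coercive_def)

lemma norm_bound_add:
  assumes "A \<in> carrier_mat n m" "B \<in> carrier_mat n m" "norm_bound A a" "norm_bound B b"
  shows "norm_bound (A + B) (a + b)"
  using assms by (auto simp: norm_bound_def intro!: order_trans[OF norm_triangle_ineq] add_mono)

text \<open>
  With \<open>D = g M\<close> every coupling is a nonnegative multiple of \<open>M\<close>, so it suffices to bound
  \<open>W j\<close> in terms of \<open>M\<close>. A definite \<open>M\<close> does this by its own coercivity; a singular one by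
  the shape of the pivots.
\<close>

lemma proportional_unique_stable:
  assumes M: "M \<in> carrier_mat 2 2" "pos_semidef M"
  shows "\<exists>f. \<forall>D lam1 lam2 g r. problem_data D lam1 lam2 \<longrightarrow>
    (\<forall>x \<in> arg_dom. 0 \<le> g x \<and> D x = g x \<cdot>\<^sub>m M) \<longrightarrow> 0 < r \<longrightarrow> LU_stable_for f r D lam1 lam2"
proof -
  have "M\<^sup>T $$ (0, 1) = M $$ (0, 1)" using M(2) by (simp add: pos_semidef_def)
  then have "M $$ (1, 0) = M $$ (0, 1)" using M(1) by simp
  then obtain m1 m2 m4 where M_eq: "M = mat2 m1 m2 m2 m4" using mat_eq_mat2[OF M(1)] by metis
  have psd: "coercive 0 M"
    using M(2) by (simp add: pos_semidef_def coercive_of_pos_semidef_nonsym)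
  have coupling: "\<exists>s\<ge>0. r \<cdot>\<^sub>m D_half D w t j = s \<cdot>\<^sub>m M"
    if "\<forall>x \<in> arg_dom. 0 \<le> g x \<and> D x = g x \<cdot>\<^sub>m M" "0 < r" "0 \<le> t" for D g r t w j
  proof (intro exI conjI)
    have "0 \<le> g (w i, t)" for i using that(1) node_in_arg_dom[OF that(3), of w i] by blast
    then show "0 \<le> r * ((g (w j, t) + g (w (j + 1), t)) / 2)"
      using that(2) by (simp add: add_nonneg_nonneg)
    show "r \<cdot>\<^sub>m D_half D w t j = (r * ((g (w j, t) + g (w (j + 1), t)) / 2)) \<cdot>\<^sub>m M"
    proof -
      have "D (w i, t) = g (w i, t) \<cdot>\<^sub>m M" for i
        using that(1) node_in_arg_dom[OF that(3), of w i] by blast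
      then show ?thesis by (simp add: D_half_def M_eq mat2_arith field_simps)
    qed
  qed
  have psd_coupling: "s \<cdot>\<^sub>m M \<in> carrier_mat 2 2 \<and> coercive 0 (s \<cdot>\<^sub>m M)" if "0 \<le> s" for s
    using coercive_smult[OF M(1) psd that] M(1) by simp
  \<comment> \<open>It remains to find, for definite and for singular \<open>M\<close>, an invariant \<open>Q\<close> of the pivot parts.\<close>
  have reduce: ?thesis
    if C: "1 \<le> C"
      and diag: "\<And>a b. 0 < a \<Longrightarrow> 0 < b \<Longrightarrow> Q (mat2 a 0 0 b)"
      and step: "\<And>s a b T W. 0 \<le> s \<Longrightarrow> 0 < a \<Longrightarrow> 0 < b \<Longrightarrow> T \<in> carrier_mat 2 2 \<Longrightarrow>
        coercive (1 / 2) T \<Longrightarrow> Q T \<Longrightarrow> W \<in> carrier_mat 2 2 \<Longrightarrow> (T + s \<cdot>\<^sub>m M) * W = s \<cdot>\<^sub>m M \<Longrightarrow>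
        norm_bound W C \<and> Q (mat2 a 0 0 b + T * W)" for C Q
    unfolding LU_stable_for_def
  proof (intro exI[of _ "ratio_bound C"] allI impI)
    fix D lam1 lam2 g w and r t :: real and N :: nat
    assume data: "problem_data D lam1 lam2" "\<forall>x \<in> arg_dom. 0 \<le> g x \<and> D x = g x \<cdot>\<^sub>m M"
      and r: "0 < r" and N: "2 \<le> N" and t: "0 \<le> t"
    have K: "\<exists>a>0. \<exists>b>0. weight N j \<cdot>\<^sub>m K_block r lam1 lam2 w t j = mat2 a 0 0 b" for j
    proof -
      have "0 < weight N j * kfun r lam1 (w j, t)" "0 < weight N j * kfun r lam2 (w j, t)"
        using kfun_ge_1[OF data(1) r node_in_arg_dom[OF t], of w j] weight_bounds(1)[of N j] by simp_all
      then show ?thesis unfolding K_block_eq_mat2 mat2_arith by auto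
    qed
    show "unique_stable_block_LU (ratio_bound C N) N
        (B_block N r D lam1 lam2 w t) (U_block r D w t) (L_block N r D w t)"
    proof (rule scheme_unique_stable[OF N C, where Q = "\<lambda>_. Q"])
      show "coercive (1 / 2) (weight N j \<cdot>\<^sub>m K_block r lam1 lam2 w t j)" for j
        by (rule coercive_weighted_K_block[OF data(1) r t])
      show "r \<cdot>\<^sub>m D_half D w t j \<in> carrier_mat 2 2 \<and> coercive 0 (r \<cdot>\<^sub>m D_half D w t j)" for j
        using coupling[OF data(2) r t, of w j] psd_coupling by metis
      show "Q (weight N 1 \<cdot>\<^sub>m K_block r lam1 lam2 w t 1)"
        using K[of 1] diag by metis
      show "norm_bound W C \<and> Q (weight N (j + 1) \<cdot>\<^sub>m K_block r lam1 lam2 w t (j + 1) + T * W)"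
        if "T \<in> carrier_mat 2 2" "coercive (1 / 2) T" "Q T" "W \<in> carrier_mat 2 2"
          "(T + r \<cdot>\<^sub>m D_half D w t j) * W = r \<cdot>\<^sub>m D_half D w t j" for j T W
        using coupling[OF data(2) r t, of w j] K[of "j + 1"] step that by metis
    qed
  qed
  have "coercive 0 (mat2 m1 m2 m2 m4)" using psd M_eq by simp
  then show ?thesis
  proof (cases rule: psd_mat2_cases)
    case 1
    \<comment> \<open>If \<open>m1\<close> or \<open>m4\<close> vanishes, then so does \<open>m2\<close>, and the quotient by 0 has the right value 0.\<close>
    let ?C = "1 + \<bar>m2\<bar> / m1 + \<bar>m2\<bar> / m4"
    have C: "1 \<le> ?C" using 1 by simp
    have "\<bar>m2\<bar> \<le> ?C * m1" "\<bar>m2\<bar> \<le> ?C * m4"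
      using 1 by (cases "m1 = 0"; cases "m4 = 0"; simp add: algebra_simps add_increasing)+
    note singular = schur_singular_coupling[OF 1 C this, folded M_eq]
    show ?thesis
    proof (rule reduce[OF C, where Q = "\<lambda>T. \<exists>a>0. \<exists>b>0. \<exists>c\<ge>0. T = mat2 a 0 0 b + c \<cdot>\<^sub>m M"])
      show "\<exists>a'>0. \<exists>b'>0. \<exists>c\<ge>0. mat2 a 0 0 b = mat2 a' 0 0 b' + c \<cdot>\<^sub>m M" if "0 < a" "0 < b" for a b
        using that by (intro exI[of _ a] exI[of _ b] exI[of _ 0] conjI) (simp_all add: M_eq mat2_arith)
      fix s a b :: real and T W
      assume s: "0 \<le> s" and ab: "0 < a" "0 < b" and T: "T \<in> carrier_mat 2 2" "coercive (1 / 2) T"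
        and Q: "\<exists>a>0. \<exists>b>0. \<exists>c\<ge>0. T = mat2 a 0 0 b + c \<cdot>\<^sub>m M"
        and W: "W \<in> carrier_mat 2 2" "(T + s \<cdot>\<^sub>m M) * W = s \<cdot>\<^sub>m M"
      obtain a' b' c where pos: "0 < a'" "0 < b'" "0 \<le> c" and T_eq: "T = mat2 a' 0 0 b' + c \<cdot>\<^sub>m M"
        using Q by blast
      have "coercive (1 / 2 + 0) (T + s \<cdot>\<^sub>m M)"
        using coercive_add[of T 2 "s \<cdot>\<^sub>m M"] T psd_coupling[OF s] by blast
      then have "det (T + s \<cdot>\<^sub>m M) \<noteq> 0"
        using T psd_coupling[OF s] by (intro coercive_det_nonzero[of _ 2]) auto
      note S = singular[OF pos s T_eq W this]
      obtain c' where c': "0 \<le> c'" "T * W = c' \<cdot>\<^sub>m M" using S(2) by blast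
      show "norm_bound W ?C \<and> (\<exists>a'>0. \<exists>b'>0. \<exists>c\<ge>0. mat2 a 0 0 b + T * W = mat2 a' 0 0 b' + c \<cdot>\<^sub>m M)"
        by (intro conjI exI[of _ a] exI[of _ b] exI[of _ c'] S(1)) (simp_all add: ab c')
    qed
  next
    case (2 \<mu>)
    obtain m where m: "norm_bound M m" using norm_bound_max by blast
    let ?C = "max 1 (real 2 * m / \<mu>)"
    show ?thesis
    proof (rule reduce[of ?C "\<lambda>_. True"])
      fix s a b :: real and T W
      assume "0 \<le> s" "T \<in> carrier_mat 2 2" "coercive (1 / 2) T"
        "W \<in> carrier_mat 2 2" "(T + s \<cdot>\<^sub>m M) * W = s \<cdot>\<^sub>m M"
      then have "norm_bound W (real 2 * m / \<mu>)"
        using norm_bound_schur_of_coercive_coupling[of T 2 "1 / 2" M \<mu> m s W] M(1) M_eq 2 m by simp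
      then have "norm_bound W ?C" unfolding norm_bound_def by (simp add: le_max_iff_disj)
      then show "norm_bound W ?C \<and> True" by simp
    qed simp_all
  qed
qed

text \<open>
  Bound for the entries of the pivot parts \<open>T j\<close> when the entries of the reaction blocks are at
  most 2; one step of the recursion is the second bound in
  \<open>norm_bound_schur_of_pivot_bound\<close>.
\<close>

fun pivot_bound :: "nat \<Rightarrow> real" where
  "pivot_bound 0 = 2"
| "pivot_bound (Suc j) = 2 + 2 * pivot_bound j * (1 + 4 * pivot_bound j)"

lemma pivot_bound_ge_2: "2 \<le> pivot_bound j"
  by (induction j) simp_all

lemma pivot_bound_mono: "i \<le> j \<Longrightarrow> pivot_bound i \<le> pivot_bound j"
proof (rule lift_Suc_mono_le[of pivot_bound])
  fix j
  show "pivot_bound j \<le> pivot_bound (Suc j)"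
    using pivot_bound_ge_2[of j] zero_le_square[of "pivot_bound j"]
    by (simp add: algebra_simps del: zero_le_square)
qed

text \<open>
  Small \<open>r\<close> makes all reaction blocks bounded by 2. From then on the recursion itself bounds the
  pivots, whatever the size of \<open>D\<close>.
\<close>

lemma small_step_unique_stable:
  assumes data: "problem_data D lam1 lam2" and psd: "\<forall>x \<in> arg_dom. pos_semidef_nonsym (D x)"
    and r: "0 < r" and small: "\<And>x. x \<in> arg_dom \<Longrightarrow> kfun r lam1 x \<le> 2 \<and> kfun r lam2 x \<le> 2"
  shows "LU_stable_for (\<lambda>N. ratio_bound (1 + 4 * pivot_bound N) N) r D lam1 lam2"
  unfolding LU_stable_for_def
proof (intro allI impI, rule scheme_unique_stable[where Q = "\<lambda>j T. norm_bound T (pivot_bound j)"])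
  fix N :: nat and w and t :: real assume N: "2 \<le> N" and t: "0 \<le> t"
  then show "2 \<le> N" by simp
  let ?K = "\<lambda>j. weight N j \<cdot>\<^sub>m K_block r lam1 lam2 w t j" and ?G = "\<lambda>j. r \<cdot>\<^sub>m D_half D w t j"
  show "1 \<le> 1 + 4 * pivot_bound N" using pivot_bound_ge_2[of N] by simp
  show "coercive (1 / 2) (?K j)" for j by (rule coercive_weighted_K_block[OF data r t])
  have G: "?G j \<in> carrier_mat 2 2 \<and> coercive 0 (?G j)" for j
  proof -
    have D: "D (w i, t) \<in> carrier_mat 2 2" "coercive 0 (D (w i, t))" for i
      using data psd node_in_arg_dom[OF t, of w i]
      by (auto simp: problem_data_def coercive_of_pos_semidef_nonsym)
    have sum: "D (w j, t) + D (w (j + 1), t) \<in> carrier_mat 2 2" using D by simp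
    have "coercive (0 + 0) (D (w j, t) + D (w (j + 1), t))" using D by (intro coercive_add[of _ 2])
    then have "coercive (1 / 2 * (0 + 0)) (D_half D w t j)"
      unfolding D_half_def using sum by (intro coercive_smult[of _ 2]) auto
    moreover have cD: "D_half D w t j \<in> carrier_mat 2 2" using sum by (simp add: D_half_def)
    ultimately have "coercive (r * (1 / 2 * (0 + 0))) (?G j)"
      using r by (intro coercive_smult[of _ 2]) auto
    then show ?thesis using cD by simp
  qed
  then show "?G j \<in> carrier_mat 2 2 \<and> coercive 0 (?G j)" for j .
  have K_le: "norm_bound (?K j) 2" for j
  proof -
    have k: "1 \<le> kfun r lam1 (w j, t)" "1 \<le> kfun r lam2 (w j, t)"
        "kfun r lam1 (w j, t) \<le> 2" "kfun r lam2 (w j, t) \<le> 2"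
      using kfun_ge_1[OF data r] small node_in_arg_dom[OF t, of w j] by auto
    have "\<bar>weight N j * k\<bar> \<le> 2" if "1 \<le> k" "k \<le> 2" for k
      using that mult_mono[of "weight N j" 1 k 2] weight_bounds[of N j] by (simp add: abs_mult)
    then show ?thesis
      using k by (simp add: K_block_eq_mat2 mat2_arith norm_bound_mat2_iff)
  qed
  have mono: "norm_bound P b" if "norm_bound P a" "a \<le> b" for P :: "real mat" and a b
    using that by (force simp: norm_bound_def)
  show "norm_bound (?K 1) (pivot_bound 1)" using mono[OF K_le pivot_bound_ge_2] .
  show "norm_bound W (1 + 4 * pivot_bound N) \<and>
      norm_bound (?K (j + 1) + T * W) (pivot_bound (j + 1))"
    if j: "j \<in> {1..N - 1}" and T: "T \<in> carrier_mat 2 2" "coercive (1 / 2) T"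
      "norm_bound T (pivot_bound j)" and W: "W \<in> carrier_mat 2 2" "(T + ?G j) * W = ?G j" for j T W
  proof
    note bounds = norm_bound_schur_of_pivot_bound
      [OF T conjunct1[OF G] conjunct2[OF G] W]
    have "pivot_bound j \<le> pivot_bound N" using j by (intro pivot_bound_mono) auto
    then show "norm_bound W (1 + 4 * pivot_bound N)" by (intro mono[OF bounds(1)]) simp
    have "?K (j + 1) \<in> carrier_mat 2 2" by (simp add: K_block_eq_mat2)
    then show "norm_bound (?K (j + 1) + T * W) (pivot_bound (j + 1))"
      using norm_bound_add[OF _ mult_carrier_mat[OF T(1) W(1)] K_le bounds(2)] by simp
  qed
qed

theorem theorem4:
  shows
    "(\<forall>M \<in> carrier_mat 2 2. pos_semidef M \<longrightarrow>
        (\<exists>f :: nat \<Rightarrow> real. \<forall>D lam1 lam2. \<forall>g :: point \<Rightarrow> real.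
           problem_data D lam1 lam2 \<longrightarrow>
           (\<forall>x \<in> arg_dom. 0 \<le> g x \<and> D x = g x \<cdot>\<^sub>m M) \<longrightarrow>
           (\<forall>r > 0. conditions pos_semidef r D lam1 lam2 \<longrightarrow> LU_stable_for f r D lam1 lam2)))
     \<and>
     (\<exists>f :: nat \<Rightarrow> real. \<forall>D lam1 lam2.
        problem_data D lam1 lam2 \<longrightarrow>
        (\<forall>x \<in> arg_dom. pos_semidef_nonsym (D x)) \<longrightarrow>
        (\<exists>r0 > 0. \<forall>r. 0 < r \<and> r < r0 \<longrightarrow>
           conditions pos_def r D lam1 lam2 \<longrightarrow> LU_stable_for f r D lam1 lam2))"
proof (intro conjI ballI impI)
  fix M :: "real mat" assume M: "M \<in> carrier_mat 2 2" "pos_semidef M"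
  obtain f where f: "\<forall>D lam1 lam2 g r. problem_data D lam1 lam2 \<longrightarrow>
    (\<forall>x \<in> arg_dom. 0 \<le> g x \<and> D x = g x \<cdot>\<^sub>m M) \<longrightarrow> 0 < r \<longrightarrow> LU_stable_for f r D lam1 lam2"
    using proportional_unique_stable[OF M] by (elim exE)
  show "\<exists>f :: nat \<Rightarrow> real. \<forall>D lam1 lam2. \<forall>g :: point \<Rightarrow> real.
      problem_data D lam1 lam2 \<longrightarrow> (\<forall>x \<in> arg_dom. 0 \<le> g x \<and> D x = g x \<cdot>\<^sub>m M) \<longrightarrow>
      (\<forall>r > 0. conditions pos_semidef r D lam1 lam2 \<longrightarrow> LU_stable_for f r D lam1 lam2)"
  proof (intro exI[of _ f] allI impI)
    fix D lam1 lam2 and r :: real and g :: "point \<Rightarrow> real"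
    assume "problem_data D lam1 lam2" "\<forall>x \<in> arg_dom. 0 \<le> g x \<and> D x = g x \<cdot>\<^sub>m M" "0 < r"
    then show "LU_stable_for f r D lam1 lam2" using f by blast
  qed
next
  let ?f = "\<lambda>N. ratio_bound (1 + 4 * pivot_bound N) N"
  show "\<exists>f :: nat \<Rightarrow> real. \<forall>D lam1 lam2.
      problem_data D lam1 lam2 \<longrightarrow> (\<forall>x \<in> arg_dom. pos_semidef_nonsym (D x)) \<longrightarrow>
      (\<exists>r0 > 0. \<forall>r. 0 < r \<and> r < r0 \<longrightarrow>
         conditions pos_def r D lam1 lam2 \<longrightarrow> LU_stable_for f r D lam1 lam2)"
  proof (intro exI[of _ ?f] allI impI)
    fix D lam1 lam2
    assume data: "problem_data D lam1 lam2" and psd: "\<forall>x \<in> arg_dom. pos_semidef_nonsym (D x)"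
    obtain b1 b2 where b: "\<forall>x \<in> arg_dom. lam1 x \<le> b1" "\<forall>x \<in> arg_dom. lam2 x \<le> b2"
      using data by (auto simp: problem_data_def bdd_above_def)
    \<comment> \<open>Below \<open>r0 = 2 / ?b\<close> one has \<open>r * lam x / 2 \<le> 1\<close>.\<close>
    let ?b = "1 + \<bar>b1\<bar> + \<bar>b2\<bar>"
    have small: "kfun r lam x \<le> 2" if "lam x \<le> ?b" "0 < r" "r < 2 / ?b" for r lam x
    proof -
      have "r * lam x \<le> r * ?b" using that by (intro mult_left_mono) auto
      also have "\<dots> < 2" using that(3) by (simp add: pos_less_divide_eq)
      finally show ?thesis by (simp add: kfun_def)
    qed
    have "LU_stable_for ?f r D lam1 lam2" if r: "0 < r" "r < 2 / ?b" for r
    proof (rule small_step_unique_stable[OF data psd r(1)])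
      fix x assume "x \<in> arg_dom"
      from b[THEN bspec, OF this] have "lam1 x \<le> ?b" "lam2 x \<le> ?b" by linarith+
      then show "kfun r lam1 x \<le> 2 \<and> kfun r lam2 x \<le> 2" using small r by blast
    qed
    moreover have "0 < 2 / ?b" by (simp add: add_pos_nonneg)
    ultimately show "\<exists>r0 > 0. \<forall>r. 0 < r \<and> r < r0 \<longrightarrow> conditions pos_def r D lam1 lam2 \<longrightarrow>
        LU_stable_for ?f r D lam1 lam2"
      by blast
  qed
qed

end
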